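(* Let $n\ge 1$ and let $k_1,\dots,k_I$ be positive integers with $k_1+\cdots+k_I=n$. The set of all real symmetric $n\times n$ matrices which have exactly $I$ distinct eigenvalues, with multiplicities $k_1,\dots,k_I$ (the values of the eigenvalues being otherwise unrestricted), has real dimension $$\frac{n(n-1)}{2}+I-\sum_{i=1}^I \frac{k_i(k_i-1)}{2}.$$
   Context: "Real dimension" of a subset of the vector space of real $n\times n$ matrices is the usual dimension over $\mathbb R$ (of a real manifold, or of a semialgebraic set). *)

theory Defs
  imports "HOL-Analysis.Analysis" "HOL-Computational_Algebra.Polynomial"
begin

definition eigenvalues :: "real^'n^'n \<Rightarrow> real set" where
  "eigenvalues A = {x. \<exists>v. v \<noteq> 0 \<and> A *v v = x *\<^sub>R v}"

definition charpoly :: "real^'n^'n \<Rightarrow> real poly" where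
  "charpoly A = det (\<chi> i j. (if i = j then [:0, 1:] else 0) - [:A $ i $ j:])"

definition alg_multiplicity :: "real^'n^'n \<Rightarrow> real \<Rightarrow> nat" where
  "alg_multiplicity A x = order x (charpoly A)"

text \<open>The eigenvalues \<open>l 1, \<dots>, l I\<close> are listed in an arbitrary order, so only the multiset of the
  multiplicities \<open>k 1, \<dots>, k I\<close> matters.\<close>

definition symmetric_matrices_with_multiplicities ::
    "nat \<Rightarrow> (nat \<Rightarrow> nat) \<Rightarrow> (real^'n^'n) set" where
  "symmetric_matrices_with_multiplicities I k =
    {A. transpose A = A \<and>
        (\<exists>l :: nat \<Rightarrow> real. inj_on l {1..I} \<and> eigenvalues A = l ` {1..I} \<and>
           (\<forall>i\<in>{1..I}. alg_multiplicity A (l i) = k i))}"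

definition C1_on :: "'a::euclidean_space set \<Rightarrow> ('a \<Rightarrow> 'b::euclidean_space) \<Rightarrow> bool" where
  "C1_on U f \<longleftrightarrow>
    (\<exists>f' :: 'a \<Rightarrow> 'a \<Rightarrow>\<^sub>L 'b. (\<forall>x\<in>U. (f has_derivative blinfun_apply (f' x)) (at x)) \<and>
       continuous_on U f')"

definition C1_diffeomorphism ::
    "'a::euclidean_space set \<Rightarrow> 'a set \<Rightarrow> ('a \<Rightarrow> 'a) \<Rightarrow> ('a \<Rightarrow> 'a) \<Rightarrow> bool" where
  "C1_diffeomorphism U V f g \<longleftrightarrow>
    open U \<and> open V \<and> homeomorphism U V f g \<and> C1_on U f \<and> C1_on V g"

definition C1_submanifold :: "nat \<Rightarrow> 'a::euclidean_space set \<Rightarrow> bool" where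
  "C1_submanifold d M \<longleftrightarrow>
    (\<forall>p\<in>M. \<exists>U V f g T. p \<in> U \<and> C1_diffeomorphism U V f g \<and>
       subspace T \<and> dim T = d \<and> f ` (M \<inter> U) = T \<inter> V)"

text \<open>The dimension of an arbitrary subset of a Euclidean space, after Lojasiewicz: the largest
  dimension of a nonempty submanifold contained in it. On an embedded submanifold this is its
  dimension as a manifold (by invariance of domain), and on a semialgebraic set it is the
  semialgebraic dimension, that is, the largest dimension of a stratum of a semialgebraic
  stratification. The supremum is over a set of naturals bounded by the dimension of the ambient
  space, so it is a maximum unless \<open>S\<close> is empty; \<open>real_dim {} = 0\<close> by convention.\<close>

definition real_dim :: "'a::euclidean_space set \<Rightarrow> nat" where
  "real_dim S = Sup {d. \<exists>M. M \<noteq> {} \<and> M \<subseteq> S \<and> C1_submanifold d M}"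

lemma C1_submanifold_dim_le:
  fixes M :: "'a::euclidean_space set"
  assumes "C1_submanifold d M" "M \<noteq> {}"
  shows "d \<le> DIM('a)"
  using assms unfolding C1_submanifold_def by (metis dim_subset_UNIV ex_in_conv)

end

theory Submission
  imports Defs
begin

text \<open>
  A symmetric matrix with eigenvalue multiplicities \<open>k 1, \<dots>, k I\<close> is \<open>Q D Q\<^sup>T\<close> with \<open>Q\<close>
  orthogonal and \<open>D\<close> diagonal and constant on the blocks of the multiplicities; perturbing it costs
  one parameter per eigenvalue and one per entry of an upper block that is not diagonal. The space of
  these parameters, the block model, has the asserted dimension.

  Lower bound: letting \<open>Q\<close> run through the Cayley transforms of skew matrices without diagonal
  blocks embeds a neighbourhood of \<open>0\<close> in the block model. The parametrization extends to the space
  of all matrices with invertible derivative at \<open>0\<close>, so the inverse function theorem supplies an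
  ambient chart.

  Upper bound: near each of its points, a matrix \<open>A\<close> of the set is determined by the upper blocks that
  are not diagonal and the traces of the diagonal blocks, in an eigenbasis of the centre. Indeed, if
  \<open>u\<close> and \<open>w\<close> are eigenvectors of \<open>A\<close> and \<open>A'\<close> close to basis vectors of the same block, then
  \<open>u \<bullet> (A - A' - \<delta>) w = 0\<close>, where \<open>\<delta>\<close> is the difference of the two eigenvalues. So the diagonal
  blocks of \<open>A - A'\<close> are scalar up to a small multiple of \<open>A - A'\<close>, and if their traces vanish then
  \<open>A = A'\<close>. Invariance of domain now bounds the dimension of every submanifold.
\<close>

section \<open>Orthonormal eigenbases of symmetric matrices\<close>

lemma symmetric_inner_mult:
  fixes A :: "real^'n^'n"
  assumes "transpose A = A"
  shows "x \<bullet> (A *v y) = (A *v x) \<bullet> y"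
  by (metis assms dot_lmul_matrix matrix_transpose_mul transpose_matrix_vector transpose_transpose)

text \<open>A maximizer of the Rayleigh quotient on the unit sphere of \<open>W\<close> is an
  eigenvector: the residual \<open>w\<close> lies in \<open>W\<close>, so it is an admissible
  direction of variation, and the first variation of
  \<open>x \<bullet> (A *v x) - m * (x \<bullet> x)\<close> along it is
  \<open>2 * (w \<bullet> w)\<close>.\<close>

lemma symmetric_eigenvector_in_subspace:
  fixes A :: "real^'n^'n"
  assumes sym: "transpose A = A" and W: "subspace W" and inv: "\<And>x. x \<in> W \<Longrightarrow> A *v x \<in> W"
    and ne: "\<exists>x\<in>W. x \<noteq> 0"
  obtains x m where "x \<in> W" "norm x = 1" "A *v x = m *\<^sub>R x"
proof -
  let ?S = "W \<inter> sphere 0 1"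
  obtain z where z: "z \<in> W" "z \<noteq> 0" using ne by blast
  have "z /\<^sub>R norm z \<in> ?S" using z W by (simp add: subspace_scale)
  moreover have "compact ?S"
    using W by (metis closed_subspace closed_Int_compact compact_sphere)
  moreover have "continuous_on ?S (\<lambda>x. x \<bullet> (A *v x))"
    by (intro continuous_intros linear_continuous_on matrix_vector_mul_bounded_linear)
  ultimately obtain x where x: "x \<in> ?S" and mx: "\<And>y. y \<in> ?S \<Longrightarrow> y \<bullet> (A *v y) \<le> x \<bullet> (A *v x)"
    using continuous_attains_sup[of ?S "\<lambda>x. x \<bullet> (A *v x)"] by blast
  define m where "m = x \<bullet> (A *v x)"
  have le: "y \<bullet> (A *v y) \<le> m * (y \<bullet> y)" if "y \<in> W" for y
  proof (cases "y = 0")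
    case False
    have "(y /\<^sub>R norm y) \<bullet> (A *v (y /\<^sub>R norm y)) \<le> m"
      unfolding m_def using that False W by (intro mx) (simp add: subspace_scale)
    then have "(y \<bullet> (A *v y)) / (norm y)^2 \<le> m"
      by (simp add: matrix_vector_mult_scaleR power2_eq_square field_simps)
    then show ?thesis using False by (simp add: divide_simps power2_norm_eq_inner split: if_splits)
  qed auto
  define w where "w = A *v x - m *\<^sub>R x"
  have xx: "x \<bullet> x = 1" using x by (simp add: norm_eq_1)
  have w: "w \<in> W" unfolding w_def using x inv W by (auto simp: subspace_diff subspace_scale)
  have 1: "w \<bullet> (A *v x) = w \<bullet> w + m * (w \<bullet> x)" unfolding w_def by (simp add: inner_simps algebra_simps)
  have ws: "x \<bullet> (A *v w) = w \<bullet> (A *v x)"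
    by (metis inner_commute symmetric_inner_mult sym)
  have key: "2 * t * (w \<bullet> w) \<le> t^2 * (m * (w \<bullet> w) - w \<bullet> (A *v w))" for t
  proof -
    have "(x + t *\<^sub>R w) \<bullet> (A *v (x + t *\<^sub>R w)) \<le> m * ((x + t *\<^sub>R w) \<bullet> (x + t *\<^sub>R w))"
      using le x w W by (simp add: subspace_add subspace_scale)
    then have "m + 2 * t * (w \<bullet> (A *v x)) + t^2 * (w \<bullet> (A *v w)) \<le> m + 2 * t * m * (w \<bullet> x) + t^2 * m * (w \<bullet> w)"
      by (simp add: matrix_vector_right_distrib matrix_vector_mult_scaleR inner_simps ws xx m_def[symmetric]
          inner_commute[of x w] power2_eq_square algebra_simps)
    then show ?thesis unfolding 1 by (simp add: algebra_simps)
  qed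
  define c where "c = m * (w \<bullet> w) - w \<bullet> (A *v w)"
  have "w \<bullet> w = 0"
  proof (rule ccontr)
    assume "w \<bullet> w \<noteq> 0"
    then have p: "w \<bullet> w > 0" by (metis inner_gt_zero_iff inner_zero_left)
    \<comment> \<open>Small enough that \<open>t * c\<close> is at most
      \<open>w \<bullet> w\<close>; the summand 1 keeps the denominator positive when
      \<open>c = 0\<close>.\<close>
    define t where "t = (w \<bullet> w) / (\<bar>c\<bar> + 1)"
    have t: "t > 0" using p by (simp add: t_def)
    have "2 * t * (w \<bullet> w) \<le> t * (t * c)" using key[of t] by (simp add: c_def power2_eq_square mult.assoc)
    then have "2 * (w \<bullet> w) \<le> t * c" using t by (metis mult.assoc mult.left_commute mult_le_cancel_left_pos)
    also have "\<dots> \<le> t * (\<bar>c\<bar> + 1)" using t by (intro mult_left_mono) auto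
    also have "\<dots> = w \<bullet> w" by (simp add: t_def add_nonneg_eq_0_iff)
    finally show False using p by simp
  qed
  then have "A *v x = m *\<^sub>R x" by (simp add: w_def)
  then show ?thesis using that x by auto
qed

definition orthonormal_family :: "('n \<Rightarrow> real^'n) \<Rightarrow> bool" where
  "orthonormal_family f \<longleftrightarrow> (\<forall>a c. f a \<bullet> f c = (if a = c then 1 else 0))"

text \<open>Take an orthonormal set of eigenvectors of maximal cardinality. By symmetry its
  orthogonal complement is invariant, so a nonzero complement would contain one more
  eigenvector.\<close>

lemma symmetric_eigenbasis:
  fixes A :: "real^'n^'n"
  assumes sym: "transpose A = A"
  obtains f d where "orthonormal_family f" "\<And>a. A *v f a = d a *\<^sub>R f a"
proof -
  define P where "P F \<longleftrightarrow> pairwise orthogonal F \<and> (\<forall>x\<in>F. norm x = 1 \<and> (\<exists>m. A *v x = m *\<^sub>R x))"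
    for F :: "(real^'n) set"
  have ind: "independent F" if "P F" for F
    using that by (intro pairwise_orthogonal_independent) (auto simp: P_def)
  have bound: "card F \<le> CARD('n)" if "P F" for F
    using independent_bound[OF ind[OF that]] by simp
  have "P {}" by (simp add: P_def)
  then obtain F where F: "P F" and mx: "\<And>G. P G \<Longrightarrow> card G \<le> card F"
    using ex_has_greatest_nat[of P "{}" card "Suc CARD('n)"] bound by (auto simp: less_Suc_eq_le)
  have finF: "finite F" using ind[OF F] independent_bound by blast
  define W where "W = {x. \<forall>f\<in>F. x \<bullet> f = 0}"
  have W: "subspace W" by (auto simp: W_def subspace_def inner_simps)
  have inv: "A *v x \<in> W" if "x \<in> W" for x
    using that F unfolding W_def P_def by (force simp: symmetric_inner_mult[OF sym, symmetric])
  have W0: "x = 0" if "x \<in> W" for x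
  proof (rule ccontr)
    assume "x \<noteq> 0"
    then obtain y m where y: "y \<in> W" "norm y = 1" "A *v y = m *\<^sub>R y"
      using symmetric_eigenvector_in_subspace[OF sym W inv] \<open>x \<in> W\<close> by metis
    have "y \<notin> F"
    proof
      assume "y \<in> F"
      then have "y \<bullet> y = 0" using y(1) by (auto simp: W_def)
      then show False using y(2) by simp
    qed
    moreover have "P (insert y F)"
      using F y unfolding P_def W_def
      by (auto simp: pairwise_insert orthogonal_def inner_commute)
    ultimately show False using mx[of "insert y F"] finF by simp
  qed
  have "card F = CARD('n)"
  proof (rule ccontr)
    assume "card F \<noteq> CARD('n)"
    then have "dim F < DIM(real^'n)" using bound[OF F] dim_eq_card_independent[OF ind[OF F]] by simp
    then obtain x where "x \<noteq> 0" "\<And>y. y \<in> span F \<Longrightarrow> orthogonal x y"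
      using orthogonal_to_subspace_exists[of F] by blast
    then show False using W0 by (auto simp: W_def orthogonal_def span_base)
  qed
  \<comment> \<open>Equal cardinality lets the matrix indices themselves index the basis, so that
    block labels can live on \<open>'n\<close>.\<close>
  then obtain f :: "'n \<Rightarrow> real^'n" where f: "bij_betw f UNIV F"
    using finite_same_card_bij[of "UNIV::'n set" F] finF by auto
  have fF: "f a \<in> F" for a using f by (auto simp: bij_betw_def)
  have "orthonormal_family f"
    unfolding orthonormal_family_def
  proof (intro allI)
    fix a c
    show "f a \<bullet> f c = (if a = c then 1 else 0)"
    proof (cases "a = c")
      case True
      then show ?thesis using F fF[of a] by (simp add: P_def norm_eq_1)
    next
      case False
      then have "f a \<noteq> f c" using f by (metis UNIV_I bij_betw_def inj_onD)
      then show ?thesis using F fF[of a] fF[of c] False by (auto simp: P_def pairwise_def orthogonal_def)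
    qed
  qed
  moreover have "\<exists>d. \<forall>a. A *v f a = d a *\<^sub>R f a"
  proof (rule choice, rule allI)
    show "\<exists>m. A *v f a = m *\<^sub>R f a" for a using F fF[of a] unfolding P_def by blast
  qed
  ultimately show ?thesis using that by blast
qed

text \<open>Orthogonality makes the members independent, and there are enough of them to span. The
  residual \<open>?y\<close> is orthogonal to each of them, hence to itself.\<close>

lemma orthonormal_family_expand:
  fixes f :: "'n::finite \<Rightarrow> real^'n"
  assumes "orthonormal_family f"
  shows "x = (\<Sum>a\<in>UNIV. (x \<bullet> f a) *\<^sub>R f a)"
proof -
  let ?y = "x - (\<Sum>a\<in>UNIV. (x \<bullet> f a) *\<^sub>R f a)"
  have fo: "f a \<bullet> f c = (if a = c then 1 else 0)" for a c using assms by (simp add: orthonormal_family_def)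
  have inj: "inj f"
    by (rule injI) (metis fo zero_neq_one)
  have z: "0 \<notin> range f" using fo by (metis imageE inner_zero_left zero_neq_one)
  have "independent (range f)"
    using z by (intro pairwise_orthogonal_independent) (auto simp: pairwise_def orthogonal_def fo)
  moreover have "card (range f) = DIM(real^'n)" using inj by (simp add: card_image)
  ultimately have "span (range f) = UNIV" by (metis card_eq_dim dim_eq_full independent_imp_finite subset_UNIV dim_eq_card_independent)
  moreover have "?y \<bullet> v = 0" if "v \<in> span (range f)" for v
    using that
  proof (induction rule: span_induct)
    case base
    show ?case by (auto simp: subspace_def inner_simps)
  next
    case (step v)
    then show ?case by (auto simp: inner_simps inner_sum_left fo if_distrib cong: if_cong)
  qed
  ultimately have "?y \<bullet> ?y = 0" by blast
  then show ?thesis by simp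
qed

lemma orthonormal_family_inner:
  fixes f :: "'n::finite \<Rightarrow> real^'n"
  assumes "orthonormal_family f"
  shows "x \<bullet> y = (\<Sum>a\<in>UNIV. (x \<bullet> f a) * (y \<bullet> f a))"
  using arg_cong[OF orthonormal_family_expand[OF assms, of y], of "\<lambda>z. x \<bullet> z"]
  by (simp add: inner_sum_right mult.commute)


lemma eigenbasis_inner_mult:
  fixes A :: "real^'n^'n"
  assumes f: "orthonormal_family f" and ev: "\<And>a. A *v f a = d a *\<^sub>R f a"
  shows "(A *v v) \<bullet> f a = d a * (v \<bullet> f a)"
proof -
  have fo: "f a \<bullet> f c = (if a = c then 1 else 0)" for a c using f by (simp add: orthonormal_family_def)
  have "A *v v = (\<Sum>c\<in>UNIV. (v \<bullet> f c) *\<^sub>R (d c *\<^sub>R f c))"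
    using arg_cong[OF orthonormal_family_expand[OF f, of v], of "\<lambda>z. A *v z"]
    by (simp add: matrix_vector_mult_scaleR ev linear_sum[OF matrix_vector_mul_linear])
  then show ?thesis
    by (simp add: inner_sum_left inner_simps fo if_distrib mult.commute cong: if_cong)
qed

lemma eigenvalues_eigenbasis:
  fixes A :: "real^'n^'n"
  assumes f: "orthonormal_family f" and ev: "\<And>a. A *v f a = d a *\<^sub>R f a"
  shows "eigenvalues A = range d"
proof
  show "range d \<subseteq> eigenvalues A"
  proof
    fix x assume "x \<in> range d"
    then obtain a where a: "x = d a" by blast
    have "f a \<bullet> f a = 1" using f by (simp add: orthonormal_family_def)
    then have "f a \<noteq> 0" by auto
    then show "x \<in> eigenvalues A" unfolding eigenvalues_def a using ev by blast
  qed
  show "eigenvalues A \<subseteq> range d"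
  proof
    fix x assume "x \<in> eigenvalues A"
    then obtain v where v: "v \<noteq> 0" "A *v v = x *\<^sub>R v" by (auto simp: eigenvalues_def)
    have "\<exists>a. v \<bullet> f a \<noteq> 0"
      using v(1) orthonormal_family_inner[OF f, of v v] by (metis (no_types, lifting) inner_eq_zero_iff mult_zero_left sum.neutral)
    then obtain a where a: "v \<bullet> f a \<noteq> 0" by blast
    have "x * (v \<bullet> f a) = d a * (v \<bullet> f a)"
      using eigenbasis_inner_mult[OF f ev, of v a] v(2) by simp
    then show "x \<in> range d" using a by simp
  qed
qed

section \<open>Characteristic polynomial and multiplicities\<close>

lemma poly_det: "poly (det M) x = det (\<chi> i j. poly (M $ i $ j) x)"
  for M :: "'a::comm_ring_1 poly^'n^'n"
  by (simp add: det_def poly_sum poly_prod)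

lemma order_prod_linear:
  fixes d :: "'i \<Rightarrow> real"
  assumes "finite S"
  shows "order x (\<Prod>a\<in>S. [:- d a, 1:]) = card {a\<in>S. d a = x}"
  using assms
proof (induction S)
  case (insert a S)
  have "[:- d a, 1:] * (\<Prod>a\<in>S. [:- d a, 1:]) \<noteq> 0"
    unfolding mult_eq_0_iff prod_zero_iff[OF insert.hyps(1)] by simp
  then have "order x ([:- d a, 1:] * (\<Prod>a\<in>S. [:- d a, 1:])) = order x [:- d a, 1:] + order x (\<Prod>a\<in>S. [:- d a, 1:])"
    by (rule order_mult)
  moreover have "order x [:- d a, 1:] = (if d a = x then 1 else 0)"
    using order_power_n_n[of x 1] by (auto intro!: order_0I)
  moreover have "card {c \<in> insert a S. d c = x} = (if d a = x then 1 else 0) + card {c\<in>S. d c = x}"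
  proof (cases "d a = x")
    case True
    then have "{c \<in> insert a S. d c = x} = insert a {c\<in>S. d c = x}" by auto
    then show ?thesis using insert.hyps True by simp
  next
    case False
    then have "{c \<in> insert a S. d c = x} = {c\<in>S. d c = x}" by auto
    then show ?thesis using False by simp
  qed
  ultimately show ?case unfolding prod.insert[OF insert.hyps] using insert.IH by presburger
qed simp

text \<open>Over the polynomial ring, \<open>C\<close> intertwines \<open>X A\<close> with
  \<open>X D\<close>, where \<open>C\<close> is \<open>Q\<close> with its entries read as constant
  polynomials. Multiplicativity of the determinant then replaces a conjugation, and only
  \<open>det C\<close> has to be cancelled.\<close>

lemma alg_multiplicity_eigenbasis:
  fixes A :: "real^'n^'n"
  assumes f: "orthonormal_family f" and ev: "\<And>a. A *v f a = d a *\<^sub>R f a"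
  shows "alg_multiplicity A x = card {a. d a = x}"
proof -
  have fo: "f a \<bullet> f c = (if a = c then 1 else 0)" for a c using f by (simp add: orthonormal_family_def)
  define X where "X A = (\<chi> i j. (if i = j then [:0, 1:] else 0) - [:A $ i $ j:])" for A :: "real^'n^'n"
  define Q where "Q = (\<chi> i a. f a $ i)"
  define C where "C = (\<chi> i a. [:f a $ i:])"
  define D where "D = (\<chi> a c. if a = c then d a else 0)"
  have eq: "(\<Sum>j\<in>UNIV. A $ i $ j * f a $ j) = f a $ i * d a" for i a
    using arg_cong[OF ev[of a], of "\<lambda>v. v $ i"] by (simp add: matrix_vector_mult_def mult.commute)
  have s: "(\<Sum>j\<in>S. [:g j:]) = [:\<Sum>j\<in>S. g j:]" for g :: "'n \<Rightarrow> real" and S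
    by (induction S rule: infinite_finite_induct) auto
  have "X A ** C = C ** X D"
    unfolding vec_eq_iff
  proof (intro allI)
    fix i a
    have "(X A ** C) $ i $ a = (\<Sum>j\<in>UNIV. (if i = j then [:0, f a $ i:] else 0)) - (\<Sum>j\<in>UNIV. [:A $ i $ j * f a $ j:])"
      unfolding sum_subtractf[symmetric] by (auto simp: X_def C_def matrix_matrix_mult_def intro!: sum.cong)
    also have "\<dots> = [:- (f a $ i * d a), f a $ i:]" by (simp add: s eq)
    also have "\<dots> = (\<Sum>j\<in>UNIV. (if j = a then [:- (f a $ i * d a), f a $ i:] else 0))" by simp
    also have "\<dots> = (\<Sum>j\<in>UNIV. [:f j $ i:] * ((if j = a then [:0, 1:] else 0) - [:if j = a then d j else 0:]))"
      by (rule sum.cong) (auto simp: mult.commute)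
    also have "\<dots> = (C ** X D) $ i $ a"
      by (simp only: X_def C_def D_def matrix_matrix_mult_def vec_lambda_beta)
    finally show "(X A ** C) $ i $ a = (C ** X D) $ i $ a" .
  qed
  then have deq: "det (X A) * det C = det C * det (X D)"
    using det_mul[of "X A" C] det_mul[of C "X D"] by presburger
  have "transpose Q ** Q = mat 1"
    using fo by (simp add: vec_eq_iff matrix_matrix_mult_def transpose_def Q_def mat_def inner_vec_def)
  then have "det Q * det Q = 1" using det_mul[of "transpose Q" Q] by (simp add: det_transpose)
  then have "det Q \<noteq> 0" by auto
  \<comment> \<open>As a polynomial \<open>det C\<close> is constant, and orthogonality of
    \<open>Q\<close> keeps its value from vanishing.\<close>
  moreover have "poly (det C) y = det Q" for y
    by (simp add: poly_det C_def Q_def)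
  ultimately have "det C \<noteq> 0" by fastforce
  then have "charpoly A = det (X D)" using deq by (simp add: charpoly_def X_def mult.commute)
  also have "\<dots> = (\<Prod>a\<in>UNIV. X D $ a $ a)" by (intro det_diagonal) (auto simp: X_def D_def)
  also have "\<dots> = (\<Prod>a\<in>UNIV. [:- d a, 1:])" by (simp add: X_def D_def)
  finally show ?thesis by (simp add: alg_multiplicity_def order_prod_linear)
qed


section \<open>The block model\<close>

text \<open>The entries above the diagonal blocks move the eigenspaces; the diagonal, constant on each
  block, moves the eigenvalues.\<close>

definition block_model :: "('n::finite \<Rightarrow> nat) \<Rightarrow> (real^'n^'n) set" where
  "block_model b = {X. (\<forall>a c. a \<noteq> c \<longrightarrow> \<not> b a < b c \<longrightarrow> X $ a $ c = 0) \<and>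
     (\<exists>x. \<forall>a. X $ a $ a = x (b a))}"

lemma subspace_block_model:
  fixes b :: "'n::finite \<Rightarrow> nat"
  shows "subspace (block_model b)"
  unfolding subspace_def
proof (intro conjI ballI allI)
  show "x + y \<in> block_model b" if xy: "x \<in> block_model b" "y \<in> block_model b" for x y
  proof -
    have "\<exists>u. \<forall>a. x $ a $ a = u (b a)" "\<exists>v. \<forall>a. y $ a $ a = v (b a)"
      using xy unfolding block_model_def by simp_all
    then obtain u v where "\<forall>a. x $ a $ a = u (b a)" "\<forall>a. y $ a $ a = v (b a)" by metis
    then have "\<exists>w. \<forall>a. (x + y) $ a $ a = w (b a)"
      by (intro exI[of _ "\<lambda>i. u i + v i"]) simp
    then show ?thesis using xy unfolding block_model_def by simp
  qed
  show "c *\<^sub>R x \<in> block_model b" if xy: "x \<in> block_model b" for x c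
  proof -
    have "\<exists>u. \<forall>a. x $ a $ a = u (b a)"
      using xy unfolding block_model_def by simp
    then obtain u where "\<forall>a. x $ a $ a = u (b a)" by metis
    then have "\<exists>w. \<forall>a. (c *\<^sub>R x) $ a $ a = w (b a)"
      by (intro exI[of _ "\<lambda>i. c * u i"]) simp
    then show ?thesis using xy unfolding block_model_def by simp
  qed
  have "\<exists>w. \<forall>a. (0::real^'n^'n) $ a $ a = w (b a)"
    by (rule exI[of _ "\<lambda>_. 0"]) simp
  then show "0 \<in> block_model b" unfolding block_model_def by simp
qed

text \<open>The matrix units \<open>E r\<close> above the diagonal blocks and the identities
  \<open>D i\<close> of the single blocks form an orthogonal basis.\<close>

lemma dim_block_model:
  fixes b :: "'n::finite \<Rightarrow> nat"
  shows "dim (block_model b) = card {(a, c). b a < b c} + card (range b)"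
proof -
  define E :: "'n \<times> 'n \<Rightarrow> real^'n^'n" where "E r = (\<chi> p q. if (p, q) = r then 1 else 0)" for r
  define D :: "nat \<Rightarrow> real^'n^'n" where "D i = (\<chi> p q. if p = q \<and> b p = i then 1 else 0)" for i
  let ?P = "{(a, c). b a < b c}"
  let ?B = "E ` ?P \<union> D ` range b"
  have inE: "E r \<bullet> Y = Y $ fst r $ snd r" for r Y
  proof (cases r)
    case (Pair a c)
    have "E r \<bullet> Y = (\<Sum>i\<in>UNIV. if i = a then \<Sum>j\<in>UNIV. if j = c then Y $ a $ c else 0 else 0)"
      unfolding E_def Pair inner_vec_def[of "\<chi> p q. if (p, q) = (a, c) then 1 else 0"]
    proof (rule sum.cong[OF refl])
      fix i
      show "(\<chi> p q. if (p, q) = (a, c) then 1 else 0) $ i \<bullet> Y $ i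
          = (if i = a then \<Sum>j\<in>UNIV. if j = c then Y $ a $ c else 0 else 0)"
        by (cases "i = a") (simp_all add: inner_vec_def if_distrib[of "\<lambda>x. x * _"] cong: if_cong)
    qed
    then show ?thesis using Pair by simp
  qed
  have inD: "D i \<bullet> Y = (\<Sum>p\<in>UNIV. if b p = i then Y $ p $ p else 0)" for i Y
  proof -
    have "D i \<bullet> Y = (\<Sum>p\<in>UNIV. \<Sum>q\<in>UNIV. if q = p then (if b p = i then Y $ p $ p else 0) else 0)"
      unfolding D_def inner_vec_def by (intro sum.cong) (auto intro!: sum.cong)
    then show ?thesis by simp
  qed
  have EE: "E r \<bullet> E s = (if r = s then 1 else 0)" for r s
    unfolding inE by (simp add: E_def)
  have ED: "E r \<bullet> D i = 0" if "r \<in> ?P" for r i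
    using that unfolding inE by (auto simp: D_def)
  have DD: "D i \<bullet> D j = 0" if "i \<noteq> j" for i j
    using that unfolding inD by (auto simp: D_def intro!: sum.neutral)
  \<comment> \<open>Restricted to labels that occur: \<open>D i\<close> is zero for \<open>i\<close>
    outside \<open>range b\<close>.\<close>
  have D0: "D (b a) \<noteq> 0" for a
  proof
    assume "D (b a) = 0"
    then have "D (b a) $ a $ a = 0" by simp
    then show False by (simp add: D_def)
  qed
  have E0: "E r \<noteq> 0" for r using EE[of r r] by auto
  have injE: "inj_on E ?P" by (rule inj_onI) (metis EE zero_neq_one)
  have injD: "inj_on D (range b)"
    by (rule inj_onI) (metis DD D0 inner_eq_zero_iff rangeE)
  have disj: "E ` ?P \<inter> D ` range b = {}"
  proof (rule equals0I)
    fix z assume "z \<in> E ` ?P \<inter> D ` range b"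
    then obtain r i where "r \<in> ?P" "z = E r" "z = D i" by blast
    then have "z \<bullet> z = 0" using ED by metis
    then show False using E0 \<open>z = E r\<close> by simp
  qed
  have "card ?B = card ?P + card (range b)"
    using disj injE injD by (subst card_Un_disjoint) (auto simp: card_image)
  moreover have "independent ?B"
  proof (rule pairwise_orthogonal_independent)
    show "pairwise orthogonal ?B"
      unfolding pairwise_def orthogonal_def using EE ED DD by (auto simp: inner_commute) (metis inner_commute ED)+
    show "0 \<notin> ?B" using E0 D0 by (auto; metis)
  qed
  moreover have "?B \<subseteq> block_model b"
  proof -
    have "E r \<in> block_model b" if "r \<in> ?P" for r
    proof -
      have "\<exists>x. \<forall>a. E r $ a $ a = x (b a)"
        using that by (intro exI[of _ "\<lambda>_. 0"]) (auto simp: E_def)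
      then show ?thesis using that unfolding block_model_def by (auto simp: E_def)
    qed
    moreover have "D i \<in> block_model b" for i
    proof -
      have "\<exists>x. \<forall>a. D i $ a $ a = x (b a)"
        by (intro exI[of _ "\<lambda>j. if j = i then 1 else 0"]) (auto simp: D_def)
      then show ?thesis unfolding block_model_def by (simp add: D_def)
    qed
    ultimately show ?thesis by blast
  qed
  moreover have "block_model b \<subseteq> span ?B"
  proof
    fix X assume X: "X \<in> block_model b"
    then obtain x where x: "x (b a) = X $ a $ a" for a
      unfolding block_model_def by force
    let ?Y = "(\<Sum>r\<in>?P. (X $ fst r $ snd r) *\<^sub>R E r) + (\<Sum>i\<in>range b. x i *\<^sub>R D i)"
    have "X $ p $ q = ?Y $ p $ q" for p q
    proof -
      have 1: "(\<Sum>r\<in>?P. (X $ fst r $ snd r) *\<^sub>R E r) $ p $ q = (if b p < b q then X $ p $ q else 0)"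
      proof -
        have "(\<Sum>r\<in>?P. (X $ fst r $ snd r) *\<^sub>R E r) $ p $ q = (\<Sum>r\<in>?P. if r = (p, q) then X $ p $ q else 0)"
          unfolding sum_component by (rule sum.cong) (auto simp: E_def)
        then show ?thesis by simp
      qed
      have 2: "(\<Sum>i\<in>range b. x i *\<^sub>R D i) $ p $ q = (if p = q then X $ p $ p else 0)"
      proof -
        have "(\<Sum>i\<in>range b. x i *\<^sub>R D i) $ p $ q = (\<Sum>i\<in>range b. if i = b p then (if p = q then X $ p $ p else 0) else 0)"
          unfolding sum_component by (rule sum.cong) (auto simp: D_def x)
        then show ?thesis by simp
      qed
      show ?thesis
        using X unfolding vector_add_component 1 2 by (auto simp: block_model_def)
    qed
    then have "X = ?Y" unfolding vec_eq_iff by blast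
    also have "\<dots> \<in> span ?B"
      by (intro span_add span_sum span_scale; rule span_base; blast)
    finally show "X \<in> span ?B" .
  qed
  ultimately show ?thesis
    using dim_unique[of ?B "block_model b"] by simp
qed

text \<open>Index pairs are split by comparing labels: swapping exchanges the two strict cases, and
  equal labels are counted block by block. Doubling avoids subtraction and division in the
  naturals.\<close>

lemma card_less_pairs:
  fixes b :: "'n::finite \<Rightarrow> nat"
  shows "2 * card {(a, c). b a < b c} + (\<Sum>i\<in>range b. card {a. b a = i} ^ 2) = CARD('n) ^ 2"
proof -
  let ?L = "{(a, c). b a < b c}" and ?G = "{(a, c). b c < b a}" and ?E = "{(a, c). b a = b c}"
  have U: "(UNIV :: ('n \<times> 'n) set) = ?L \<union> (?G \<union> ?E)" by auto
  have "CARD('n) ^ 2 = CARD('n \<times> 'n)" by (simp add: power2_eq_square)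
  also have "\<dots> = card ?L + (card ?G + card ?E)"
  proof -
    have "card (?L \<union> (?G \<union> ?E)) = card ?L + card (?G \<union> ?E)"
      by (rule card_Un_disjoint) auto
    moreover have "card (?G \<union> ?E) = card ?G + card ?E"
      by (rule card_Un_disjoint) auto
    ultimately show ?thesis using arg_cong[OF U, of card] by simp
  qed
  also have "card ?G = card ?L"
    by (rule bij_betw_same_card[of prod.swap]) (auto simp: bij_betw_def image_iff)
  also have "card ?E = card (SIGMA a:UNIV. {c. b a = b c})"
    by (rule arg_cong[of _ _ card]) auto
  also have "\<dots> = (\<Sum>a\<in>UNIV. card {c. b a = b c})" by simp
  also have "\<dots> = (\<Sum>i\<in>range b. \<Sum>a\<in>{a. b a = i}. card {c. b a = b c})"
    using sum.image_gen[of UNIV "\<lambda>a. card {c. b a = b c}" b] by simp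
  also have "\<dots> = (\<Sum>i\<in>range b. card {a. b a = i} ^ 2)"
  proof (rule sum.cong[OF refl])
    fix i
    have "(\<Sum>a\<in>{a. b a = i}. card {c. b a = b c}) = (\<Sum>a\<in>{a. b a = i}. card {a. b a = i})"
      by (rule sum.cong) (auto intro!: arg_cong[of _ _ card])
    then show "(\<Sum>a\<in>{a. b a = i}. card {c. b a = b c}) = card {a. b a = i} ^ 2"
      by (simp add: power2_eq_square)
  qed
  finally show ?thesis by simp
qed

text \<open>The value depends on \<open>b\<close> only through its fibre sizes, so labellings that
  come from different matrices give the same dimension.\<close>

lemma real_dim_block_model:
  fixes b :: "'n::finite \<Rightarrow> nat"
  assumes r: "range b = {1..I}" and c: "\<And>i. i \<in> {1..I} \<Longrightarrow> card {a. b a = i} = k i"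
    and s: "(\<Sum>i=1..I. k i) = CARD('n)"
  shows "real (dim (block_model b)) = real CARD('n) * (real CARD('n) - 1) / 2 + real I
      - (\<Sum>i=1..I. real (k i) * (real (k i) - 1) / 2)"
proof -
  have "2 * card {(a, c). b a < b c} + (\<Sum>i=1..I. k i ^ 2) = CARD('n) ^ 2"
    using card_less_pairs[of b] c unfolding r by simp
  then have e: "2 * real (card {(a, c). b a < b c}) + (\<Sum>i=1..I. real (k i) ^ 2) = real CARD('n) ^ 2"
    by (metis (mono_tags, lifting) of_nat_add of_nat_mult of_nat_numeral of_nat_power of_nat_sum sum.cong)
  have "(\<Sum>i=1..I. real (k i) * (real (k i) - 1) / 2) = ((\<Sum>i=1..I. real (k i) ^ 2) - (\<Sum>i=1..I. real (k i))) / 2"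
    by (simp add: sum_divide_distrib[symmetric] sum_subtractf power2_eq_square algebra_simps)
  also have "(\<Sum>i=1..I. real (k i)) = real CARD('n)" using s by (metis of_nat_sum)
  finally have "(\<Sum>i=1..I. real (k i) * (real (k i) - 1) / 2)
      = (real CARD('n) ^ 2 - 2 * real (card {(a, c). b a < b c}) - real CARD('n)) / 2"
    using e by simp
  moreover have "real (dim (block_model b)) = real (card {(a, c). b a < b c}) + real I"
    unfolding dim_block_model r by simp
  ultimately show ?thesis by (simp only:) (simp add: power2_eq_square diff_divide_distrib right_diff_distrib)
qed


section \<open>Submanifolds from parametrizations\<close>

text \<open>In finite dimension, continuity in every fixed direction implies continuity in the
  operator norm, so a derivative can be handled as a plain family of maps.\<close>

lemma has_derivative_imp_blinfun:
  fixes f :: "'a::euclidean_space \<Rightarrow> 'b::euclidean_space"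
  assumes der: "\<And>x. x \<in> U \<Longrightarrow> (f has_derivative F x) (at x)"
    and cont: "\<And>h. continuous_on U (\<lambda>x. F x h)"
  obtains f' where "\<And>x. x \<in> U \<Longrightarrow> blinfun_apply (f' x) = F x" "continuous_on U f'"
proof -
  have ap: "blinfun_apply (Blinfun (F x)) = F x" if "x \<in> U" for x
    using der[OF that] by (intro bounded_linear_Blinfun_apply) (rule has_derivative_bounded_linear)
  moreover have "continuous_on U (\<lambda>x. Blinfun (F x))"
  proof (rule continuous_on_blinfun_componentwise)
    fix i :: 'a
    show "continuous_on U (\<lambda>x. blinfun_apply (Blinfun (F x)) i)"
      using cont[of i] by (rule continuous_on_eq) (simp add: ap)
  qed
  ultimately show ?thesis by (intro that[of "\<lambda>x. Blinfun (F x)"])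
qed

lemma C1_onI:
  assumes "\<And>x. x \<in> U \<Longrightarrow> (f has_derivative F x) (at x)"
    and "\<And>h. continuous_on U (\<lambda>x. F x h)"
  shows "C1_on U f"
proof -
  obtain f' where "\<And>x. x \<in> U \<Longrightarrow> blinfun_apply (f' x) = F x" "continuous_on U f'"
    using has_derivative_imp_blinfun[OF assms] by metis
  then show ?thesis unfolding C1_on_def using assms(1) by (intro exI[of _ f']) simp
qed

text \<open>Needed for the local inverse to be C1, since its derivative is an inverse operator. The
  lower bound \<open>B\<close> for \<open>A y0\<close> persists as \<open>B / 2\<close> for nearby
  \<open>A y\<close>, which controls the difference of the solutions.\<close>

lemma continuous_on_inv_blinfun:
  fixes A :: "'a::t2_space \<Rightarrow> ('b::euclidean_space \<Rightarrow>\<^sub>L 'b)"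
  assumes A: "continuous_on V A" and bij: "\<And>y. y \<in> V \<Longrightarrow> bij (blinfun_apply (A y))"
  shows "continuous_on V (\<lambda>y. inv (blinfun_apply (A y)) h)"
  unfolding continuous_on_def
proof
  fix y0 assume y0: "y0 \<in> V"
  let ?v = "\<lambda>y. inv (blinfun_apply (A y)) h"
  have inj0: "inj (blinfun_apply (A y0))" using bij[OF y0] by (simp add: bij_def)
  obtain B where B: "B > 0" "\<And>x. B * norm x \<le> norm (A y0 x)"
    using linear_inj_bounded_below_pos[OF blinfun.bounded_linear_right[of "A y0", THEN bounded_linear.linear] inj0]
    by blast
  have lim: "((\<lambda>y. norm (A y - A y0)) \<longlongrightarrow> 0) (at y0 within V)"
    using A y0 by (simp add: continuous_on_def tendsto_norm_zero_iff Lim_null[symmetric])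
  have "eventually (\<lambda>y. norm (A y - A y0) < B / 2) (at y0 within V)"
    using order_tendstoD(2)[OF lim, of "B / 2"] B by simp
  then have "eventually (\<lambda>y. norm (?v y - ?v y0) \<le> norm (A y - A y0) * (2 * norm (?v y0) / B)) (at y0 within V)"
  proof (rule eventually_mp[rotated])
    show "eventually (\<lambda>y. norm (A y - A y0) < B / 2 \<longrightarrow>
        norm (?v y - ?v y0) \<le> norm (A y - A y0) * (2 * norm (?v y0) / B)) (at y0 within V)"
      unfolding eventually_at_filter
    proof (intro always_eventually allI impI)
      fix y assume y: "y \<in> V" and small: "norm (A y - A y0) < B / 2"
      let ?w = "?v y - ?v y0"
      have e: "blinfun_apply (A z) (?v z) = h" if "z \<in> V" for z
        using bij[OF that] by (simp add: bij_is_surj surj_f_inv_f)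
      \<comment> \<open>Both solutions have the same right side \<open>h\<close>, so only the change
        of the operator at the fixed vector \<open>?v y0\<close> remains.\<close>
      have "A y ?w = (A y0 - A y) (?v y0)"
        using e[OF y] e[OF y0] by (simp add: blinfun.bilinear_simps)
      then have 1: "norm (A y ?w) \<le> norm (A y - A y0) * norm (?v y0)"
        by (metis norm_blinfun norm_minus_commute)
      \<comment> \<open>The term \<open>B / 2 * norm ?w\<close> at the end of this chain is absorbed
        into the left side.\<close>
      have "B * norm ?w \<le> norm (A y0 ?w)" by (rule B)
      also have "A y0 ?w = A y ?w - (A y - A y0) ?w" by (simp add: blinfun.bilinear_simps)
      also have "norm \<dots> \<le> norm (A y ?w) + norm ((A y - A y0) ?w)" by (rule norm_triangle_ineq4)
      also have "\<dots> \<le> norm (A y - A y0) * norm (?v y0) + B / 2 * norm ?w"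
        using 1 small norm_blinfun[of "A y - A y0" ?w]
        by (smt (verit) mult_right_mono norm_ge_zero)
      finally have "B / 2 * norm ?w \<le> norm (A y - A y0) * norm (?v y0)" by simp
      then show "norm ?w \<le> norm (A y - A y0) * (2 * norm (?v y0) / B)"
        using B(1) by (simp add: field_simps)
    qed
  qed
  moreover have "((\<lambda>y. norm (A y - A y0) * (2 * norm (?v y0) / B)) \<longlongrightarrow> 0) (at y0 within V)"
    by (rule tendsto_mult_left_zero[OF lim])
  ultimately have "((\<lambda>y. ?v y - ?v y0) \<longlongrightarrow> 0) (at y0 within V)"
    by (rule Lim_null_comparison)
  then show "(?v \<longlongrightarrow> ?v y0) (at y0 within V)" by (simp add: Lim_null[symmetric])
qed

text \<open>Since \<open>g\<close> maps the ambient space to itself with invertible derivative at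
  \<open>x0\<close>, its local inverse straightens the image of \<open>T\<close> and serves as an
  ambient chart. The piece \<open>M\<close> is cut down to \<open>U'\<close>, where that inverse
  exists.\<close>

lemma C1_submanifold_of_parametrization:
  fixes g :: "'a::euclidean_space \<Rightarrow> 'a"
  assumes U: "open U" "x0 \<in> U" and T: "subspace T" "x0 \<in> T"
    and der: "\<And>x. x \<in> U \<Longrightarrow> (g has_derivative F x) (at x)"
    and cont: "\<And>h. continuous_on U (\<lambda>x. F x h)"
    and inj: "inj (F x0)"
  obtains M where "M \<noteq> {}" "M \<subseteq> g ` (T \<inter> U)" "C1_submanifold (dim T) M"
proof -
  obtain f' where f': "\<And>x. x \<in> U \<Longrightarrow> blinfun_apply (f' x) = F x" "continuous_on U f'"
    using has_derivative_imp_blinfun[OF der cont] by metis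
  have lin: "linear (F x0)" using der[OF U(2)] by (rule has_derivative_linear)
  \<comment> \<open>A linear left inverse is the form of invertibility that the inverse function
    theorem asks for.\<close>
  obtain h where h: "linear h" "h \<circ> F x0 = id"
    using linear_injective_left_inverse[OF lin inj] by blast
  have "Blinfun h o\<^sub>L f' x0 = id_blinfun"
  proof (rule blinfun_eqI)
    fix v
    show "blinfun_apply (Blinfun h o\<^sub>L f' x0) v = blinfun_apply id_blinfun v"
      using h f'(1)[OF U(2)]
      by (simp add: bounded_linear_Blinfun_apply linear_linear pointfree_idE)
  qed
  moreover have "(g has_derivative blinfun_apply (f' x)) (at x)" if "x \<in> U" for x
    using der f'(1) that by simp
  ultimately obtain U' V gi g' where U': "open U'" "U' \<subseteq> U" "x0 \<in> U'" and V: "open V" "g x0 \<in> V"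
    and hom: "homeomorphism U' V g gi"
    and dgi: "\<And>y. y \<in> V \<Longrightarrow> (gi has_derivative (g' y)) (at y)"
    and g': "\<And>y. y \<in> V \<Longrightarrow> g' y = inv (blinfun_apply (f' (gi y)))"
    and bij: "\<And>y. y \<in> V \<Longrightarrow> bij (blinfun_apply (f' (gi y)))"
    using inverse_function_theorem[OF U(1) _ f'(2) U(2)] by metis
  have C1g: "C1_on U' g"
    using U' der continuous_on_subset[OF cont] by (intro C1_onI[where F = F]) auto
  have "continuous_on V gi" and giV: "gi ` V = U'"
    using hom by (auto simp: homeomorphism_def)
  then have "continuous_on V (\<lambda>y. f' (gi y))"
    using U'(2) f'(2) by (metis continuous_on_compose2)
  then have "continuous_on V (\<lambda>y. inv (blinfun_apply (f' (gi y))) h)" for h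
    using bij by (rule continuous_on_inv_blinfun)
  then have "continuous_on V (\<lambda>y. g' y h)" for h
    by (rule continuous_on_eq) (simp add: g')
  then have C1gi: "C1_on V gi"
    using dgi by (intro C1_onI[where F = g'])
  \<comment> \<open>The chart is the inverse of the parametrization, hence the exchanged order of
    \<open>V\<close> and \<open>U'\<close>.\<close>
  have diff: "C1_diffeomorphism V U' gi g"
    unfolding C1_diffeomorphism_def
    using U' V C1g C1gi hom by (simp add: homeomorphism_symD)
  define M where "M = g ` (T \<inter> U')"
  have MV: "M \<subseteq> V" using hom by (auto simp: M_def homeomorphism_def)
  have "gi ` (M \<inter> V) = T \<inter> U'"
  proof -
    have "gi ` (M \<inter> V) = gi ` g ` (T \<inter> U')" using MV by (simp add: M_def Int_absorb2)
    also have "\<dots> = T \<inter> U'"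
      using hom unfolding homeomorphism_def image_image by (auto simp: image_iff)
    finally show ?thesis .
  qed
  then have "C1_submanifold (dim T) M"
    unfolding C1_submanifold_def using MV diff T(1) by blast
  moreover have "M \<noteq> {}" using U'(3) T(2) by (auto simp: M_def)
  moreover have "M \<subseteq> g ` (T \<inter> U)" using U'(2) by (auto simp: M_def)
  ultimately show ?thesis using that by blast
qed


section \<open>Cayley parametrization\<close>

text \<open>Supplies the product rule, norm bounds and continuity for matrix products.\<close>

interpretation matrix_mult: bounded_bilinear "(**) :: real^'m^'n \<Rightarrow> real^'p^'m \<Rightarrow> real^'p^'n"
proof -
  have "bilinear ((**) :: real^'m^'n \<Rightarrow> real^'p^'m \<Rightarrow> real^'p^'n)"
    unfolding bilinear_def linear_iff
    by (auto simp: vec_eq_iff matrix_matrix_mult_def sum_distrib_left sum.distrib algebra_simps)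
  then show "bounded_bilinear ((**) :: real^'m^'n \<Rightarrow> real^'p^'m \<Rightarrow> real^'p^'n)"
    by (simp add: bilinear_conv_bounded_bilinear)
qed

lemma linear_transpose: "linear (transpose :: real^'m^'n \<Rightarrow> real^'n^'m)"
  by (auto simp: linear_iff vec_eq_iff transpose_def)

lemma transpose_plus: "transpose (A + B) = transpose A + transpose B" for A :: "real^'m^'n"
  by (simp add: vec_eq_iff transpose_def)

lemma transpose_minus: "transpose (A - B) = transpose A - transpose B" for A :: "real^'m^'n"
  by (simp add: vec_eq_iff transpose_def)

definition skew_part :: "('n::finite \<Rightarrow> nat) \<Rightarrow> real^'n^'n \<Rightarrow> real^'n^'n" where
  "skew_part b X = (\<chi> a c. if b a < b c then X $ a $ c else if b c < b a then - X $ c $ a else 0)"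

text \<open>Complementary to \<open>skew_part\<close>: together they see every entry of
  \<open>X\<close>. On \<open>block_model b\<close> only the diagonal survives here; the other
  entries make the derivative injective on the whole matrix space.\<close>

definition block_part :: "('n::finite \<Rightarrow> nat) \<Rightarrow> real^'n^'n \<Rightarrow> real^'n^'n" where
  "block_part b X = (\<chi> a c. if b a < b c then 0 else X $ a $ c)"

text \<open>The inverse exists for every \<open>X\<close>, because \<open>skew_part b X\<close> is
  skew, so no smallness condition has to be carried along.\<close>

definition resolvent :: "('n::finite \<Rightarrow> nat) \<Rightarrow> real^'n^'n \<Rightarrow> real^'n^'n" where
  "resolvent b X = matrix_inv (mat 1 - skew_part b X)"

lemma linear_skew_part: "linear (skew_part b)"
  by (auto simp: linear_iff vec_eq_iff skew_part_def)

lemma linear_block_part: "linear (block_part b)"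
  by (auto simp: linear_iff vec_eq_iff block_part_def)

lemma transpose_skew_part: "transpose (skew_part b X) = - skew_part b X"
  by (auto simp: vec_eq_iff transpose_def skew_part_def)

lemma skew_inner_self:
  fixes K :: "real^'n^'n"
  assumes "transpose K = - K"
  shows "v \<bullet> (K *v v) = 0"
proof -
  have "v \<bullet> (K *v v) = (transpose K *v v) \<bullet> v"
    by (simp add: dot_lmul_matrix[symmetric] transpose_matrix_vector)
  also have "\<dots> = - (v \<bullet> (K *v v))"
    by (simp add: assms vec.neg inner_commute matrix_vector_mult_def sum_negf inner_vec_def)
  finally show ?thesis by simp
qed

text \<open>The vector \<open>K *v v\<close> is orthogonal to \<open>v\<close>, so subtracting it
  cannot shorten \<open>v\<close>. This yields both the invertibility of \<open>mat 1 - K\<close>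
  and a bound on its inverse that is uniform in \<open>K\<close>.\<close>

lemma norm_one_minus_skew:
  fixes K :: "real^'n^'n"
  assumes "transpose K = - K"
  shows "norm v \<le> norm ((mat 1 - K) *v v)"
proof (cases "v = 0")
  case False
  have "norm v * norm v = v \<bullet> ((mat 1 - K) *v v)"
    using skew_inner_self[OF assms, of v]
    by (simp add: matrix_vector_mult_diff_rdistrib inner_diff_right power2_norm_eq_inner[symmetric] power2_eq_square)
  also have "\<dots> \<le> norm v * norm ((mat 1 - K) *v v)" by (rule norm_cauchy_schwarz)
  finally show ?thesis using False by simp
qed simp

lemma invertible_one_minus_skew:
  fixes K :: "real^'n^'n"
  assumes "transpose K = - K"
  shows "invertible (mat 1 - K)"
proof -
  have "v = 0" if "(mat 1 - K) *v v = 0" for v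
    using norm_one_minus_skew[OF assms, of v] that by simp
  then show ?thesis
    by (metis invertible_left_inverse matrix_left_invertible_ker)
qed

lemma resolvent_inverse:
  "(mat 1 - skew_part b X) ** resolvent b X = mat 1"
  "resolvent b X ** (mat 1 - skew_part b X) = mat 1"
  unfolding resolvent_def matrix_inv_def
  using someI_ex[OF invertible_one_minus_skew[OF transpose_skew_part, unfolded invertible_def]] by blast+

text \<open>Each column has norm at most 1, because \<open>mat 1 - skew_part b X\<close> does not
  shorten vectors. Summing over entries is crude, but only uniformity in \<open>X\<close>
  matters.\<close>

lemma norm_resolvent:
  fixes X :: "real^'n^'n"
  shows "norm (resolvent b X) \<le> real CARD('n) * real CARD('n)"
proof -
  have "\<bar>resolvent b X $ i $ j\<bar> \<le> 1" for i j
  proof -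
    let ?v = "resolvent b X *v axis j 1"
    have "norm ?v \<le> norm ((mat 1 - skew_part b X) *v ?v)"
      by (rule norm_one_minus_skew[OF transpose_skew_part])
    also have "\<dots> = 1" by (simp add: matrix_vector_mul_assoc resolvent_inverse)
    finally show ?thesis using component_le_norm_cart[of ?v i]
      by (simp add: matrix_vector_mult_basis column_def)
  qed
  then have "norm (resolvent b X $ i) \<le> real CARD('n)" for i
    using norm_le_l1_cart[of "resolvent b X $ i"] sum_bounded_above[of UNIV "\<lambda>j. \<bar>resolvent b X $ i $ j\<bar>" 1]
    by (simp add: order_trans)
  moreover have "norm (resolvent b X) \<le> (\<Sum>i\<in>UNIV. norm (resolvent b X $ i))"
    unfolding norm_vec_def by (rule L2_set_le_sum) simp
  ultimately show ?thesis
    using sum_bounded_above[of UNIV "\<lambda>i. norm (resolvent b X $ i)" "real CARD('n)"] by (simp add: order_trans)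
qed

text \<open>The resolvent identity: \<open>skew_part b (Y - X)\<close> is the difference of the two
  matrices being inverted, and each outer factor cancels one of them.\<close>

lemma resolvent_diff:
  "resolvent b Y - resolvent b X = resolvent b Y ** skew_part b (Y - X) ** resolvent b X"
proof -
  let ?RX = "resolvent b X" and ?RY = "resolvent b Y"
  have "skew_part b (Y - X) = (mat 1 - skew_part b X) - (mat 1 - skew_part b Y)"
    by (simp add: linear_diff[OF linear_skew_part])
  then have "?RY ** skew_part b (Y - X) ** ?RX
      = ?RY ** ((mat 1 - skew_part b X) ** ?RX) - (?RY ** (mat 1 - skew_part b Y)) ** ?RX"
    by (simp add: matrix_mult.diff_left matrix_mult.diff_right matrix_mul_assoc)
  then show ?thesis by (simp add: resolvent_inverse)
qed

text \<open>The remainder is quadratic in \<open>Y - X\<close>, and the uniform bound on resolvents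
  makes its constant independent of \<open>Y\<close>.\<close>

lemma resolvent_has_derivative:
  fixes X :: "real^'n^'n"
  shows "(resolvent b has_derivative (\<lambda>h. resolvent b X ** skew_part b h ** resolvent b X)) (at X)"
proof -
  have "linear (\<lambda>h. resolvent b X ** skew_part b h ** resolvent b X)"
    by (auto simp: linear_iff linear_add[OF linear_skew_part] linear_scale[OF linear_skew_part]
        matrix_mult.add_left matrix_mult.add_right matrix_mult.scaleR_left matrix_mult.scaleR_right)
  then have bl: "bounded_linear (\<lambda>h. resolvent b X ** skew_part b h ** resolvent b X)"
    by (simp add: linear_linear)
  obtain c :: real where c: "0 < c" "\<And>(A :: real^'n^'n) (B :: real^'n^'n). norm (A ** B) \<le> norm A * norm B * c"
    using matrix_mult.pos_bounded by blast
  obtain s where s: "s > 0" "\<And>h. norm (skew_part b h) \<le> norm h * s"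
    using bounded_linear.pos_bounded[OF linear_linear[THEN iffD2, OF linear_skew_part]] by blast
  define N where "N = real CARD('n) * real CARD('n)"
  have N: "norm (resolvent b Z) \<le> N" for Z unfolding N_def by (rule norm_resolvent)
  then have N0: "0 \<le> N" by (metis norm_ge_zero order_trans)
  have tri: "norm (A ** skew_part b h ** resolvent b X) \<le> norm A * norm h * (s * N * c\<^sup>2)" for A h :: "real^'n^'n"
  proof -
    have "norm (A ** skew_part b h ** resolvent b X) \<le> norm (A ** skew_part b h) * norm (resolvent b X) * c" by (rule c)
    also have "\<dots> \<le> norm (A ** skew_part b h) * N * c"
      using N c(1) by (intro mult_right_mono mult_left_mono) auto
    also have "\<dots> \<le> (norm A * norm (skew_part b h) * c) * N * c"
      using c N0 by (intro mult_right_mono) auto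
    also have "\<dots> \<le> (norm A * (norm h * s) * c) * N * c"
      using c N0 s by (intro mult_right_mono mult_left_mono) auto
    finally show ?thesis by (simp add: power2_eq_square mult_ac)
  qed
  define C where "C = s * N * c\<^sup>2"
  have C0: "0 \<le> C" using s c N0 by (simp add: C_def)
  have quot: "norm (resolvent b Y - resolvent b X - resolvent b X ** skew_part b (Y - X) ** resolvent b X)
      / norm (Y - X) \<le> N * C * C * norm (Y - X)" if "Y \<noteq> X" for Y
  proof -
    \<comment> \<open>The resolvent identity is used once to factor out the difference of the
      resolvents and once more to bound that difference.\<close>
    have "resolvent b Y - resolvent b X - resolvent b X ** skew_part b (Y - X) ** resolvent b X
        = (resolvent b Y - resolvent b X) ** skew_part b (Y - X) ** resolvent b X"
      by (simp only: matrix_mult.diff_left resolvent_diff[of b Y X, symmetric])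
    also have "norm \<dots> \<le> norm (resolvent b Y - resolvent b X) * norm (Y - X) * C"
      unfolding C_def by (rule tri)
    also have "norm (resolvent b Y - resolvent b X) \<le> N * norm (Y - X) * C"
      unfolding resolvent_diff[of b Y X] C_def using N C0 N0
      by (intro order_trans[OF tri] mult_right_mono) (auto simp: C_def)
    finally have "norm (resolvent b Y - resolvent b X - resolvent b X ** skew_part b (Y - X) ** resolvent b X)
        \<le> (N * C * C * norm (Y - X)) * norm (Y - X)"
      using C0 by (simp add: mult_right_mono mult_ac)
    then show ?thesis
      using \<open>Y \<noteq> X\<close> by (simp add: divide_le_eq)
  qed
  have "((\<lambda>Y. N * C * C * norm (Y - X)) \<longlongrightarrow> 0) (at X)"
    by (auto intro!: tendsto_eq_intros)
  with bl quot show ?thesis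
    by (intro has_derivativeI_sandwich[of 1 _ UNIV X _ "\<lambda>Y. N * C * C * norm (Y - X)"]) auto
qed


section \<open>Description of the set by labelled eigenbases\<close>

lemma symmetric_matrices_with_multiplicities_iff:
  fixes A :: "real^'n^'n"
  shows "A \<in> symmetric_matrices_with_multiplicities I k \<longleftrightarrow> transpose A = A \<and>
    (\<exists>l b f. inj_on l {1..I} \<and> range b = {1..I} \<and> (\<forall>i\<in>{1..I}. card {a. b a = i} = k i) \<and>
       orthonormal_family f \<and> (\<forall>a. A *v f a = l (b a) *\<^sub>R f a))" (is "_ \<longleftrightarrow> _ \<and> ?R")
proof (cases "transpose A = A")
  case sym: True
  \<comment> \<open>Since \<open>l\<close> is injective, basis vectors with the same eigenvalue are
    those with the same label, so multiplicities become fibre sizes of \<open>b\<close>.\<close>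
  have fib: "{a. l (b a) = l i} = {a. b a = i}"
    if "inj_on l {1..I}" "range b = {1..I}" "i \<in> {1..I}" for l :: "nat \<Rightarrow> real" and b :: "'n \<Rightarrow> nat" and i
  proof -
    have "b a = i" if "l (b a) = l i" for a
      using inj_onD[OF \<open>inj_on l {1..I}\<close> that] \<open>range b = {1..I}\<close> \<open>i \<in> {1..I}\<close> by blast
    then show ?thesis by blast
  qed
  have ?R if A: "A \<in> symmetric_matrices_with_multiplicities I k"
  proof -
    from A obtain l where l: "inj_on l {1..I}" "eigenvalues A = l ` {1..I}"
      and m: "\<forall>i\<in>{1..I}. alg_multiplicity A (l i) = k i"
      unfolding symmetric_matrices_with_multiplicities_def by blast
    obtain f d where f: "orthonormal_family f" and ev: "\<And>a. A *v f a = d a *\<^sub>R f a"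
      using symmetric_eigenbasis[OF sym] by blast
    have rd: "range d = l ` {1..I}" using eigenvalues_eigenbasis[OF f ev] l(2) by simp
    define b where "b a = the_inv_into {1..I} l (d a)" for a
    have "d a \<in> l ` {1..I}" for a using rd by blast
    then have lb: "l (b a) = d a" for a
      unfolding b_def by (intro f_the_inv_into_f l(1))
    have "range b = the_inv_into {1..I} l ` range d" by (auto simp: b_def)
    also have "\<dots> = {1..I}" unfolding rd using l(1) by (rule the_inv_into_onto)
    finally have rb: "range b = {1..I}" .
    have "card {a. b a = i} = k i" if "i \<in> {1..I}" for i
      using m that alg_multiplicity_eigenbasis[OF f ev, of "l i"] fib[OF l(1) rb that] by (simp add: lb)
    then show ?R using l(1) rb f ev lb by metis
  qed
  moreover have "A \<in> symmetric_matrices_with_multiplicities I k" if ?R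
  proof -
    from that obtain l b f where l: "inj_on l {1..I}" and b: "range b = {1..I}"
      and c: "\<forall>i\<in>{1..I}. card {a. b a = i} = k i"
      and f: "orthonormal_family f" and ev: "\<And>a. A *v f a = l (b a) *\<^sub>R f a"
      by blast
    have "eigenvalues A = l ` {1..I}"
      using eigenvalues_eigenbasis[OF f ev] b by (simp add: image_comp[symmetric] comp_def flip: image_image)
    moreover have "alg_multiplicity A (l i) = k i" if "i \<in> {1..I}" for i
      using alg_multiplicity_eigenbasis[OF f ev, of "l i"] fib[OF l b that] c that by simp
    ultimately show ?thesis
      unfolding symmetric_matrices_with_multiplicities_def using sym l by blast
  qed
  ultimately show ?thesis using sym by blast
qed (auto simp: symmetric_matrices_with_multiplicities_def)

text \<open>Enumerate the disjoint union of the sets \<open>{..<k i}\<close> by \<open>'n\<close>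
  and take the first component as the label.\<close>

lemma ex_block_function:
  fixes k :: "nat \<Rightarrow> nat"
  assumes k: "\<And>i. i \<in> {1..I} \<Longrightarrow> k i > 0" and s: "(\<Sum>i=1..I. k i) = CARD('n::finite)"
  shows "\<exists>b :: 'n::finite \<Rightarrow> nat. range b = {1..I} \<and> (\<forall>i\<in>{1..I}. card {a. b a = i} = k i)"
proof -
  let ?S = "SIGMA i:{1..I}. {..<k i}"
  have "card ?S = CARD('n)" using s by simp
  then obtain h :: "'n \<Rightarrow> nat \<times> nat" where h: "bij_betw h UNIV ?S"
    using finite_same_card_bij[of "UNIV :: 'n set" ?S] by auto
  have "range (fst \<circ> h) = fst ` ?S" using h unfolding bij_betw_def image_comp[symmetric] by metis
  \<comment> \<open>Positivity of the \<open>k i\<close> ensures that every label occurs.\<close>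
  also have "\<dots> = {1..I}" using k by force
  finally have r: "range (fst \<circ> h) = {1..I}" .
  have "card {a. (fst \<circ> h) a = i} = k i" if "i \<in> {1..I}" for i
  proof -
    have "bij_betw h {a. (fst \<circ> h) a = i} ({i} \<times> {..<k i})"
    proof (rule bij_betw_subset[OF h])
      show "h ` {a. (fst \<circ> h) a = i} = {i} \<times> {..<k i}"
      proof
        show "h ` {a. (fst \<circ> h) a = i} \<subseteq> {i} \<times> {..<k i}"
        proof
          fix z assume "z \<in> h ` {a. (fst \<circ> h) a = i}"
          then obtain x where x: "z = h x" "fst (h x) = i" by auto
          have "h x \<in> ?S" using bij_betwE[OF h] by blast
          then show "z \<in> {i} \<times> {..<k i}" using x by (cases "h x") simp
        qed
        show "{i} \<times> {..<k i} \<subseteq> h ` {a. (fst \<circ> h) a = i}"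
        proof
          fix z assume z: "z \<in> {i} \<times> {..<k i}"
          then have "z \<in> range h" using that bij_betw_imp_surj_on[OF h] by auto
          then obtain x where x: "z = h x" by blast
          then have "fst (h x) = i" using z by (cases "h x") simp
          then show "z \<in> h ` {a. (fst \<circ> h) a = i}" using x by simp
        qed
      qed
    qed simp
    then show ?thesis by (simp add: bij_betw_same_card)
  qed
  with r show ?thesis by (intro exI[of _ "fst \<circ> h"] conjI ballI)
qed

text \<open>The centre of the parametrization. With the labels themselves as eigenvalues, distinct
  eigenvalues are at distance at least 1.\<close>

definition block_diagonal :: "('n::finite \<Rightarrow> nat) \<Rightarrow> real^'n^'n" where
  "block_diagonal b = (\<chi> a c. if a = c then real (b a) else 0)"

text \<open>Written with \<open>(1 - K)\<^sup>-\<^sup>1\<close> only: since \<open>K\<close> is skew, the transpose of this inverse is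
  \<open>(1 + K)\<^sup>-\<^sup>1\<close>.\<close>

definition cayley :: "('n::finite \<Rightarrow> nat) \<Rightarrow> real^'n^'n \<Rightarrow> real^'n^'n" where
  "cayley b X = resolvent b X ** (mat 1 + skew_part b X)"

text \<open>Polynomial in \<open>X\<close>; it is separated from the resolvents so that the
  derivative of \<open>resolvent\<close> enters only through the two outer factors of
  \<open>cayley_param\<close>.\<close>

definition cayley_core :: "('n::finite \<Rightarrow> nat) \<Rightarrow> real^'n^'n \<Rightarrow> real^'n^'n" where
  "cayley_core b X = (mat 1 + skew_part b X) ** (block_diagonal b + block_part b X) ** (mat 1 - skew_part b X)"

definition cayley_param :: "('n::finite \<Rightarrow> nat) \<Rightarrow> real^'n^'n \<Rightarrow> real^'n^'n" where
  "cayley_param b X = resolvent b X ** cayley_core b X ** transpose (resolvent b X)"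

definition cayley_core_deriv where
  "cayley_core_deriv b X h = (mat 1 + skew_part b X) ** (block_diagonal b + block_part b X) ** (- skew_part b h)
     + ((mat 1 + skew_part b X) ** block_part b h + skew_part b h ** (block_diagonal b + block_part b X))
       ** (mat 1 - skew_part b X)"

definition cayley_param_deriv where
  "cayley_param_deriv b X h = resolvent b X ** cayley_core b X ** transpose (resolvent b X ** skew_part b h ** resolvent b X)
     + (resolvent b X ** cayley_core_deriv b X h + resolvent b X ** skew_part b h ** resolvent b X ** cayley_core b X)
       ** transpose (resolvent b X)"

lemma transpose_cayley: "transpose (cayley b X) = (mat 1 - skew_part b X) ** transpose (resolvent b X)"
  by (simp add: cayley_def matrix_transpose_mul transpose_plus transpose_skew_part)

text \<open>The form from which the spectrum is read off, whereas the defining form is the one that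
  is differentiated.\<close>

lemma cayley_param_eq:
  "cayley_param b X = cayley b X ** (block_diagonal b + block_part b X) ** transpose (cayley b X)"
  unfolding transpose_cayley by (simp add: cayley_param_def cayley_core_def cayley_def matrix_mul_assoc)

text \<open>The factors \<open>mat 1 + K\<close> and \<open>mat 1 - K\<close> commute, and
  transposition exchanges them.\<close>

lemma cayley_orthogonal: "transpose (cayley b X) ** cayley b X = mat 1"
proof -
  let ?K = "skew_part b X" and ?R = "resolvent b X"
  have comm: "(mat 1 + ?K) ** (mat 1 - ?K) = (mat 1 - ?K) ** (mat 1 + ?K)"
    by (simp add: matrix_mult.add_left matrix_mult.add_right matrix_mult.diff_left matrix_mult.diff_right)
  have "cayley b X ** transpose (cayley b X) = ?R ** ((mat 1 + ?K) ** (mat 1 - ?K)) ** transpose ?R"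
    unfolding transpose_cayley by (simp add: cayley_def matrix_mul_assoc)
  also have "\<dots> = (?R ** (mat 1 - ?K)) ** (mat 1 + ?K) ** transpose ?R"
    unfolding comm by (simp add: matrix_mul_assoc)
  also have "\<dots> = transpose (?R ** (mat 1 - ?K))"
    unfolding matrix_transpose_mul by (simp add: resolvent_inverse transpose_minus transpose_skew_part)
  also have "\<dots> = mat 1" by (simp add: resolvent_inverse)
  \<comment> \<open>The chain treats the product in the opposite order; for square matrices a
    one-sided inverse is two-sided.\<close>
  finally show ?thesis using matrix_left_right_inverse by blast
qed

lemma linear_has_derivative: "linear f \<Longrightarrow> (f has_derivative f) (at x)"
  for f :: "'a::euclidean_space \<Rightarrow> 'b::real_normed_vector"
  by (simp add: bounded_linear_imp_has_derivative linear_linear)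

lemma cayley_core_has_derivative: "(cayley_core b has_derivative cayley_core_deriv b X) (at X)"
proof -
  have K: "(skew_part b has_derivative skew_part b) (at X)"
    by (rule linear_has_derivative[OF linear_skew_part])
  have L: "(block_part b has_derivative block_part b) (at X)"
    by (rule linear_has_derivative[OF linear_block_part])
  have 1: "((\<lambda>X. mat 1 + skew_part b X) has_derivative skew_part b) (at X)"
    using has_derivative_add[OF has_derivative_const K] by simp
  have 2: "((\<lambda>X. mat 1 - skew_part b X) has_derivative (\<lambda>h. - skew_part b h)) (at X)"
    using has_derivative_diff[OF has_derivative_const K] by simp
  have 3: "((\<lambda>X. block_diagonal b + block_part b X) has_derivative block_part b) (at X)"
    using has_derivative_add[OF has_derivative_const L] by simp
  show ?thesis
    using matrix_mult.FDERIV[OF matrix_mult.FDERIV[OF 1 3] 2]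
    unfolding cayley_core_def[abs_def] cayley_core_deriv_def[abs_def] by simp
qed

lemma cayley_param_has_derivative: "(cayley_param b has_derivative cayley_param_deriv b X) (at X)"
proof -
  note R = resolvent_has_derivative[of b X]
  have T: "((\<lambda>X. transpose (resolvent b X)) has_derivative
      (\<lambda>h. transpose (resolvent b X ** skew_part b h ** resolvent b X))) (at X)"
    using has_derivative_compose[OF R linear_has_derivative[OF linear_transpose]] by simp
  show ?thesis
    using matrix_mult.FDERIV[OF matrix_mult.FDERIV[OF R cayley_core_has_derivative] T]
    unfolding cayley_param_def[abs_def] cayley_param_deriv_def[abs_def] by simp
qed

lemma continuous_on_cayley_param_deriv: "continuous_on U (\<lambda>X. cayley_param_deriv b X h)"
proof -
  have c: "continuous_on U (skew_part b)" "continuous_on U (block_part b)"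
    using linear_skew_part linear_block_part by (auto intro!: linear_continuous_on simp: linear_linear)
  have R: "continuous_on U (resolvent b)"
    using resolvent_has_derivative by (meson continuous_at_imp_continuous_on has_derivative_continuous)
  have t: "continuous_on U (\<lambda>X. transpose (f X))" if "continuous_on U f" for f :: "real^'a^'a \<Rightarrow> real^'a^'a"
    using continuous_on_compose2[OF linear_continuous_on[of transpose UNIV] that] linear_transpose
    by (auto simp: linear_linear)
  show ?thesis
    unfolding cayley_param_deriv_def cayley_core_deriv_def cayley_core_def
    by (intro continuous_intros matrix_mult.continuous_on t c R)
qed

text \<open>At \<open>0\<close> the derivative is \<open>block_part + 2 (K D - D K)\<close>, and its second term multiplies the
  \<open>(a, c)\<close> entry of \<open>K\<close> by \<open>2 (b c - b a)\<close>. Hence it is triangular: the entries with \<open>b a < b c\<close> determine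
  the skew part.\<close>

lemma inj_cayley_param_deriv_0: "inj (cayley_param_deriv b 0)"
proof -
  have lin: "linear (cayley_param_deriv b 0)"
    using cayley_param_has_derivative by (rule has_derivative_linear)
  have "h = 0" if h: "cayley_param_deriv b 0 h = 0" for h
  proof -
    let ?K = "skew_part b h" and ?D = "block_diagonal b"
    have K0: "skew_part b 0 = 0" "block_part b 0 = 0"
      by (simp_all add: linear_0 linear_skew_part linear_block_part)
    have R0: "resolvent b 0 = mat 1" using resolvent_inverse(1)[of b 0] by (simp add: K0)
    have "cayley_param_deriv b 0 h = block_part b h + 2 *\<^sub>R (?K ** ?D - ?D ** ?K)"
      unfolding cayley_param_deriv_def cayley_core_deriv_def cayley_core_def R0 K0
      by (simp add: transpose_skew_part matrix_mult.minus_right scaleR_2)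
    then have e: "block_part b h + 2 *\<^sub>R (?K ** ?D - ?D ** ?K) = 0" using h by simp
    have KD: "(?K ** ?D) $ a $ c = ?K $ a $ c * real (b c)" for a c
      by (simp add: matrix_matrix_mult_def block_diagonal_def if_distrib[of "\<lambda>x. _ * x"] cong: if_cong)
    have DK: "(?D ** ?K) $ a $ c = real (b a) * ?K $ a $ c" for a c
      by (simp add: matrix_matrix_mult_def block_diagonal_def if_distrib[of "\<lambda>x. x * _"] cong: if_cong)
    have en: "block_part b h $ a $ c + 2 * ((real (b c) - real (b a)) * ?K $ a $ c) = 0" for a c
      using arg_cong[OF e, of "\<lambda>M. M $ a $ c"] by (simp add: KD DK algebra_simps)
    have up: "h $ a $ c = 0" if "b a < b c" for a c
      using en[of a c] that by (simp add: block_part_def skew_part_def)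
    \<comment> \<open>On the remaining entries \<open>?K\<close> vanishes, inside a block by
      definition and below the blocks by \<open>up\<close> for the transposed entry, so
      \<open>en\<close> leaves the entry of \<open>h\<close> alone.\<close>
    have "h $ a $ c = 0" for a c
      using en[of a c] up[of a c] up[of c a]
      by (cases "b a" "b c" rule: linorder_cases) (auto simp: block_part_def skew_part_def)
    then show "h = 0" by (simp add: vec_eq_iff)
  qed
  then show ?thesis using linear_injective_0[OF lin] by blast
qed

text \<open>On the block model the middle factor \<open>D\<close> is diagonal, and the columns of
  \<open>Q\<close> are eigenvectors. Each integer label is shifted by less than
  \<open>1 / 2\<close>, so no two of them can meet.\<close>

lemma cayley_param_mem:
  fixes X :: "real^'n^'n"
  assumes b: "range b = {1..I}" and c: "\<And>i. i \<in> {1..I} \<Longrightarrow> card {a. b a = i} = k i"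
    and X: "X \<in> block_model b" "norm X < 1 / 2"
  shows "cayley_param b X \<in> symmetric_matrices_with_multiplicities I k"
proof -
  obtain x where x: "\<And>a. X $ a $ a = x (b a)" using X(1) unfolding block_model_def by fastforce
  define l where "l i = real i + x i" for i
  define D where "D = block_diagonal b + block_part b X"
  define Q where "Q = cayley b X"
  have D: "D $ a $ c = (if a = c then l (b a) else 0)" for a c
    using X(1) x by (auto simp: D_def block_diagonal_def block_part_def block_model_def l_def)
  have QQ: "transpose Q ** Q = mat 1" unfolding Q_def by (rule cayley_orthogonal)
  have p: "cayley_param b X = Q ** D ** transpose Q" by (simp add: cayley_param_eq Q_def D_def)
  have "transpose D = D" by (simp add: vec_eq_iff transpose_def D)
  then have sym: "transpose (cayley_param b X) = cayley_param b X"
    by (simp add: p matrix_transpose_mul matrix_mul_assoc)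
  define f where "f a = Q *v axis a 1" for a
  have "f a \<bullet> f c = (if a = c then 1 else 0)" for a c
  proof -
    have "axis a 1 \<bullet> (transpose Q *v (Q *v axis c 1)) = f c \<bullet> f a"
      unfolding transpose_matrix_vector f_def inner_commute[of "axis a 1"] by (rule dot_lmul_matrix)
    then show ?thesis by (auto simp: matrix_vector_mul_assoc QQ inner_axis_axis inner_commute[of "f a"])
  qed
  then have f: "orthonormal_family f" by (simp add: orthonormal_family_def)
  have "D *v axis a 1 = l (b a) *\<^sub>R axis a 1" for a
    unfolding matrix_vector_mult_basis by (simp add: column_def vec_eq_iff axis_def D)
  moreover have "cayley_param b X *v f a = Q *v (D *v ((transpose Q ** Q) *v axis a 1))" for a
    by (simp add: p f_def matrix_vector_mul_assoc matrix_mul_assoc)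
  ultimately have ev: "cayley_param b X *v f a = l (b a) *\<^sub>R f a" for a
    by (simp add: QQ f_def matrix_vector_mult_scaleR)
  have small: "\<bar>x (b a)\<bar> < 1 / 2" for a
    using component_le_norm_cart[of "X $ a" a] Finite_Cartesian_Product.norm_nth_le[of X a] X(2) by (simp add: x)
  have "inj_on l {1..I}"
  proof (rule inj_onI)
    fix i j assume "i \<in> {1..I}" "j \<in> {1..I}" and e: "l i = l j"
    then obtain a c where "i = b a" "j = b c" using b by (metis imageE)
    then have "\<bar>real i - real j\<bar> < 1" using small[of a] small[of c] e by (auto simp: l_def)
    then show "i = j" by linarith
  qed
  then show ?thesis
    unfolding symmetric_matrices_with_multiplicities_iff using sym b c f ev by blast
qed

text \<open>Realizes the lower bound. The parametrization is differentiable everywhere; the ball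
  only keeps the eigenvalues of different blocks apart.\<close>

lemma ex_submanifold:
  fixes k :: "nat \<Rightarrow> nat" and b :: "'n::finite \<Rightarrow> nat"
  assumes b: "range b = {1..I}" and c: "\<And>i. i \<in> {1..I} \<Longrightarrow> card {a. b a = i} = k i"
  obtains M :: "(real^'n^'n) set" where "M \<noteq> {}" "M \<subseteq> symmetric_matrices_with_multiplicities I k"
    "C1_submanifold (dim (block_model b)) M"
proof -
  obtain M where "M \<noteq> {}" and M: "M \<subseteq> cayley_param b ` (block_model b \<inter> ball 0 (1/2))"
    and "C1_submanifold (dim (block_model b)) M"
    by (rule C1_submanifold_of_parametrization[of "ball 0 (1/2)" 0 "block_model b" "cayley_param b" "cayley_param_deriv b"])
      (auto simp: subspace_block_model subspace_0 cayley_param_has_derivative continuous_on_cayley_param_deriv inj_cayley_param_deriv_0)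
  moreover have "M \<subseteq> symmetric_matrices_with_multiplicities I k"
    using M cayley_param_mem[OF b c] by auto
  ultimately show ?thesis using that by blast
qed


section \<open>Local injectivity of the block coordinates\<close>

text \<open>Every \<open>l i\<close> has an eigenvalue of \<open>A\<close> within \<open>e\<close>,
  and by the gap these are distinct. As \<open>A\<close> has only \<open>I\<close> eigenvalues, no
  cluster splits, so projecting \<open>f a\<close> to the eigenspace of \<open>m (b a)\<close>
  discards only components whose eigenvalues are far from \<open>l (b a)\<close>.\<close>

lemma perturbed_eigenvectors:
  fixes A A0 :: "real^'n^'n"
  assumes f: "orthonormal_family f" and ev: "\<And>a. A0 *v f a = l (b a) *\<^sub>R f a"
    and b: "range b = {1..I}"
    and gap: "\<And>i j. \<lbrakk>i \<in> {1..I}; j \<in> {1..I}; i \<noteq> j\<rbrakk> \<Longrightarrow> \<gamma> \<le> \<bar>l i - l j\<bar>"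
    and e: "0 < e" "3 * e \<le> \<gamma>" and near: "\<And>v. norm ((A - A0) *v v) \<le> e * norm v"
    and sym: "transpose A = A" and card: "card (eigenvalues A) = I"
  obtains m u where "\<And>a. A *v u a = m (b a) *\<^sub>R u a" "\<And>a. norm (f a - u a) \<le> 2 * e / \<gamma>"
proof -
  obtain g d where g: "orthonormal_family g" and gev: "\<And>c. A *v g c = d c *\<^sub>R g c"
    using symmetric_eigenbasis[OF sym] by blast
  have rd: "eigenvalues A = range d" by (rule eigenvalues_eigenbasis[OF g gev])
  have go: "g a \<bullet> g c = (if a = c then 1 else 0)" for a c using g by (simp add: orthonormal_family_def)
  have nf: "norm (f a) = 1" for a using f by (simp add: orthonormal_family_def norm_eq_1)
  \<comment> \<open>The summands are the squared coordinates of \<open>(A - A0) *v f a\<close> in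
    the eigenbasis \<open>g\<close> of \<open>A\<close>.\<close>
  have main: "(\<Sum>c\<in>UNIV. ((d c - l (b a)) * (f a \<bullet> g c))\<^sup>2) \<le> e\<^sup>2" for a
  proof -
    let ?y = "(A - A0) *v f a"
    have y: "?y \<bullet> g c = (d c - l (b a)) * (f a \<bullet> g c)" for c
      using eigenbasis_inner_mult[OF g gev, of "f a" c]
      by (simp add: matrix_vector_mult_diff_rdistrib ev inner_diff_left left_diff_distrib)
    have "(\<Sum>c\<in>UNIV. ((d c - l (b a)) * (f a \<bullet> g c))\<^sup>2) = ?y \<bullet> ?y"
      unfolding orthonormal_family_inner[OF g, of ?y ?y] y by (simp add: power2_eq_square)
    also have "\<dots> = (norm ?y)\<^sup>2" by (simp add: power2_norm_eq_inner)
    also have "\<dots> \<le> e\<^sup>2" using near[of "f a"] nf by (simp add: power_mono)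
    finally show ?thesis .
  qed
  have one: "(\<Sum>c\<in>UNIV. (f a \<bullet> g c)\<^sup>2) = 1" for a
    using orthonormal_family_inner[OF g, of "f a" "f a"] nf[of a] by (simp add: power2_eq_square norm_eq_1)
  \<comment> \<open>The weights \<open>(f a \<bullet> g c)^2\<close> sum to 1, so by
    \<open>main\<close> not all eigenvalues \<open>d c\<close> can be farther than \<open>e\<close>
    from \<open>l i\<close>.\<close>
  have "\<exists>x \<in> range d. \<bar>x - l i\<bar> \<le> e" if i: "i \<in> {1..I}" for i
  proof (rule ccontr)
    assume "\<not> ?thesis"
    then have far: "e < \<bar>d c - l i\<bar>" for c by (auto simp: not_le)
    obtain a where a: "i = b a" using i b by blast
    have pos: "0 < (d c - l i)\<^sup>2 - e\<^sup>2" for c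
      using power_strict_mono[OF far[of c], of 2] e(1) by simp
    have "(\<Sum>c\<in>UNIV. ((d c - l i)\<^sup>2 - e\<^sup>2) * (f a \<bullet> g c)\<^sup>2) \<le> 0"
      using main[of a] one[of a] unfolding left_diff_distrib[of _ "e\<^sup>2"]
      by (simp add: a sum_subtractf power_mult_distrib sum_distrib_left[symmetric])
    moreover have nn: "0 \<le> ((d c - l i)\<^sup>2 - e\<^sup>2) * (f a \<bullet> g c)\<^sup>2" for c
      using pos[of c] by (intro mult_nonneg_nonneg) auto
    ultimately have "(\<Sum>c\<in>UNIV. ((d c - l i)\<^sup>2 - e\<^sup>2) * (f a \<bullet> g c)\<^sup>2) = 0"
      by (intro antisym sum_nonneg) auto
    then have "((d c - l i)\<^sup>2 - e\<^sup>2) * (f a \<bullet> g c)\<^sup>2 = 0" for c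
      using nn by (simp add: sum_nonneg_eq_0_iff)
    then have "(f a \<bullet> g c)\<^sup>2 = 0" for c using pos[of c] by (metis less_irrefl mult_eq_0_iff)
    then show False using one[of a] by simp
  qed
  then obtain m where m: "\<And>i. i \<in> {1..I} \<Longrightarrow> m i \<in> range d" "\<And>i. i \<in> {1..I} \<Longrightarrow> \<bar>m i - l i\<bar> \<le> e"
    by metis
  have "inj_on m {1..I}"
  proof (rule inj_onI)
    fix i j assume ij: "i \<in> {1..I}" "j \<in> {1..I}" "m i = m j"
    then have "\<bar>l i - l j\<bar> \<le> 2 * e" using m(2)[of i] m(2)[of j] by linarith
    then show "i = j" using gap[OF ij(1,2)] e by (cases "i = j") linarith+
  qed
  \<comment> \<open>Counting shows that the \<open>m i\<close> exhaust the spectrum of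
    \<open>A\<close>; this is where the number of eigenvalues enters.\<close>
  then have "card (m ` {1..I}) = card (range d)" using card rd by (simp add: card_image)
  then have rm: "m ` {1..I} = range d" using m(1) by (intro card_subset_eq) auto
  define u where "u a = (\<Sum>c | d c = m (b a). (f a \<bullet> g c) *\<^sub>R g c)" for a
  have "A *v u a = m (b a) *\<^sub>R u a" for a
    unfolding u_def linear_sum[OF matrix_vector_mul_linear] scaleR_right.sum
    by (rule sum.cong) (auto simp: matrix_vector_mult_scaleR gev)
  moreover have "norm (f a - u a) \<le> 2 * e / \<gamma>" for a
  proof -
    have "u a \<bullet> g c = (\<Sum>c'\<in>{c. d c = m (b a)}. if c' = c then f a \<bullet> g c else 0)" for c
      unfolding u_def inner_sum_left by (rule sum.cong) (auto simp: go)
    then have co: "(f a - u a) \<bullet> g c = (if d c = m (b a) then 0 else f a \<bullet> g c)" for c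
      by (simp add: inner_diff_left)
    have ba: "b a \<in> {1..I}" using b by blast
    \<comment> \<open>The gap minus the error \<open>e\<close>, which is at most a third of it,
      leaves more than half of the gap.\<close>
    have far: "(\<gamma> / 2)\<^sup>2 \<le> (d c - l (b a))\<^sup>2" if "d c \<noteq> m (b a)" for c
    proof -
      obtain j where j: "j \<in> {1..I}" "d c = m j" using rm by (metis imageE rangeI)
      then have "j \<noteq> b a" using that by auto
      then have "\<gamma> \<le> \<bar>l j - l (b a)\<bar>" using gap j ba by blast
      then have "\<gamma> / 2 \<le> \<bar>d c - l (b a)\<bar>" using m(2)[OF j(1)] e j(2) by linarith
      then show ?thesis using e by (simp add: abs_le_square_iff[symmetric])
    qed
    have "(\<gamma> / 2)\<^sup>2 * (norm (f a - u a))\<^sup>2 = (\<Sum>c\<in>UNIV. (\<gamma> / 2)\<^sup>2 * ((f a - u a) \<bullet> g c)\<^sup>2)"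
      unfolding power2_norm_eq_inner orthonormal_family_inner[OF g, of "f a - u a" "f a - u a"]
      by (simp add: sum_distrib_left power2_eq_square)
    also have "\<dots> \<le> (\<Sum>c\<in>UNIV. ((d c - l (b a)) * (f a \<bullet> g c))\<^sup>2)"
    proof (rule sum_mono)
      fix c
      show "(\<gamma> / 2)\<^sup>2 * ((f a - u a) \<bullet> g c)\<^sup>2 \<le> ((d c - l (b a)) * (f a \<bullet> g c))\<^sup>2"
        using far[of c] by (auto simp: co power_mult_distrib intro!: mult_right_mono)
    qed
    also have "\<dots> \<le> e\<^sup>2" by (rule main)
    finally have "(\<gamma> / 2 * norm (f a - u a))\<^sup>2 \<le> e\<^sup>2" by (simp only: power_mult_distrib)
    then have "\<gamma> / 2 * norm (f a - u a) \<le> e" by (rule power2_le_imp_le) (use e(1) in simp)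
    then have "norm (f a - u a) * \<gamma> \<le> 2 * e" by (simp add: mult.commute)
    moreover have "0 < \<gamma>" using e by linarith
    ultimately show ?thesis by (simp add: pos_le_divide_eq)
  qed
  ultimately show ?thesis by (rule that)
qed

text \<open>In the basis \<open>f\<close> the difference \<open>E\<close> has no entries between
  blocks, and inside a block it is nearly \<open>\<delta>\<close> times the identity. Vanishing
  traces make \<open>\<delta>\<close> small, and for small \<open>h\<close> the entries are bounded
  by a fraction of their own sum \<open>N\<close>, so \<open>N = 0\<close>.\<close>

lemma eq_of_perturbed_eigenvectors:
  fixes A A' :: "real^'n^'n" and f :: "'n \<Rightarrow> real^'n" and b :: "'n \<Rightarrow> nat"
  assumes f: "orthonormal_family f"
    and sym: "transpose A = A" "transpose A' = A'"
    and u: "\<And>a. A *v u a = m (b a) *\<^sub>R u a" "\<And>a. norm (f a - u a) \<le> h"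
    and w: "\<And>a. A' *v w a = m' (b a) *\<^sub>R w a" "\<And>a. norm (f a - w a) \<le> h"
    and h: "0 \<le> h" "24 * (real CARD('n))\<^sup>2 * h \<le> 1"
    and off: "\<And>a c. b a < b c \<Longrightarrow> f a \<bullet> (A *v f c) = f a \<bullet> (A' *v f c)"
    and tr: "\<And>i. (\<Sum>a | b a = i. f a \<bullet> (A *v f a)) = (\<Sum>a | b a = i. f a \<bullet> (A' *v f a))"
  shows "A = A'"
proof -
  have fo: "f a \<bullet> f c = (if a = c then 1 else 0)" for a c using f by (simp add: orthonormal_family_def)
  have nf: "norm (f a) = 1" for a by (simp add: norm_eq_1 fo)
  define E where "E = A - A'"
  define x where "x a c = f a \<bullet> (E *v f c)" for a c
  have symE: "transpose E = E" by (simp add: E_def transpose_minus sym)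
  have xs: "x a c = x c a" for a c
    unfolding x_def by (metis inner_commute symE symmetric_inner_mult)
  have x0: "x a c = 0" if "b a \<noteq> b c" for a c
  proof -
    have *: "x a c = 0" if "b a < b c" for a c
      using off[OF that] by (simp add: x_def E_def matrix_vector_mult_diff_rdistrib inner_diff_right)
    show ?thesis using * xs that by (metis linorder_neq_iff)
  qed
  have xtr: "(\<Sum>a | b a = i. x a a) = 0" for i
    using tr[of i] by (simp add: x_def E_def matrix_vector_mult_diff_rdistrib inner_diff_right sum_subtractf)
  \<comment> \<open>This sum bounds the operator norm of \<open>E\<close> and is also the quantity
    to be contracted.\<close>
  define N where "N = (\<Sum>a\<in>UNIV. \<Sum>c\<in>UNIV. \<bar>x a c\<bar>)"
  have N0: "0 \<le> N" unfolding N_def by (intro sum_nonneg) auto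
  have EN: "norm (E *v v) \<le> N * norm v" for v
  proof -
    have "E *v v = (\<Sum>c\<in>UNIV. (v \<bullet> f c) *\<^sub>R (E *v f c))"
      using arg_cong[OF orthonormal_family_expand[OF f, of v], of "\<lambda>z. E *v z"]
      by (simp add: linear_sum[OF matrix_vector_mul_linear] matrix_vector_mult_scaleR)
    then have co: "(E *v v) \<bullet> f a = (\<Sum>c\<in>UNIV. (v \<bullet> f c) * x a c)" for a
      by (simp add: inner_sum_left x_def inner_commute[of "f a"])
    have "E *v v = (\<Sum>a\<in>UNIV. ((E *v v) \<bullet> f a) *\<^sub>R f a)" by (rule orthonormal_family_expand[OF f])
    then have "norm (E *v v) \<le> (\<Sum>a\<in>UNIV. norm (((E *v v) \<bullet> f a) *\<^sub>R f a))" by (metis norm_sum)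
    also have "\<dots> \<le> (\<Sum>a\<in>UNIV. \<Sum>c\<in>UNIV. norm v * \<bar>x a c\<bar>)"
    proof (rule sum_mono)
      fix a
      have "norm (((E *v v) \<bullet> f a) *\<^sub>R f a) = \<bar>\<Sum>c\<in>UNIV. (v \<bullet> f c) * x a c\<bar>" by (simp add: nf co)
      also have "\<dots> \<le> (\<Sum>c\<in>UNIV. \<bar>(v \<bullet> f c) * x a c\<bar>)" by (rule sum_abs)
      also have "\<dots> \<le> (\<Sum>c\<in>UNIV. norm v * \<bar>x a c\<bar>)"
        using Cauchy_Schwarz_ineq2[of v "f _"]
        by (intro sum_mono) (simp add: abs_mult nf mult_right_mono)
      finally show "norm (((E *v v) \<bullet> f a) *\<^sub>R f a) \<le> (\<Sum>c\<in>UNIV. norm v * \<bar>x a c\<bar>)" .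
    qed
    also have "\<dots> = N * norm v" by (simp add: N_def sum_distrib_left[symmetric] mult.commute)
    finally show ?thesis .
  qed
  have n1: "1 \<le> (real CARD('n))\<^sup>2" by (simp add: Suc_le_eq)
  have h1: "24 * h \<le> 1"
  proof -
    have "1 * (24 * h) \<le> (real CARD('n))\<^sup>2 * (24 * h)" using n1 h(1) by (intro mult_right_mono) auto
    then show ?thesis using h(2) by (simp add: mult_ac)
  qed
  define \<delta> where "\<delta> i = m i - m' i" for i
  have est: "\<bar>x a c - (if a = c then \<delta> (b a) else 0)\<bar> \<le> 3 * h * (N + \<bar>\<delta> (b a)\<bar>)" if ac: "b a = b c" for a c
  proof -
    define F where "F v = E *v v - \<delta> (b a) *\<^sub>R v" for v
    have Fd: "F (v - v') = F v - F v'" for v v'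
      by (simp add: F_def matrix_vector_mult_diff_distrib scaleR_diff_right)
    have FN: "norm (F v) \<le> (N + \<bar>\<delta> (b a)\<bar>) * norm v" for v
      using norm_triangle_ineq4[of "E *v v" "\<delta> (b a) *\<^sub>R v"] EN[of v] by (simp add: F_def distrib_right)
    have "u a \<bullet> (E *v w c) = (A *v u a) \<bullet> w c - u a \<bullet> (A' *v w c)"
      by (simp add: E_def matrix_vector_mult_diff_rdistrib inner_diff_right symmetric_inner_mult[OF sym(1)])
    \<comment> \<open>Within one block the eigenvalues of \<open>u a\<close> and \<open>w c\<close>
      differ by exactly \<open>\<delta> (b a)\<close>, so the shifted operator \<open>F\<close>
      pairs these vectors to zero.\<close>
    then have uF: "u a \<bullet> F (w c) = 0"
      using u(1)[of a] w(1)[of c] ac by (simp add: F_def \<delta>_def inner_diff_right left_diff_distrib)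
    have nu: "norm (u a) \<le> 1 + h"
      using norm_triangle_ineq4[of "f a" "f a - u a"] u(2)[of a] nf[of a] by simp
    have "x a c - (if a = c then \<delta> (b a) else 0) = f a \<bullet> F (f c)"
      by (simp add: x_def F_def inner_diff_right fo)
    \<comment> \<open>The vectors \<open>f a\<close> and \<open>f c\<close> are replaced by
      \<open>u a\<close> and \<open>w c\<close> one after the other; the last remaining term is the
      vanishing pairing.\<close>
    also have "\<dots> = (f a - u a) \<bullet> F (f c) + u a \<bullet> F (f c - w c)"
      using uF by (simp add: Fd inner_diff_left inner_diff_right)
    finally have "\<bar>x a c - (if a = c then \<delta> (b a) else 0)\<bar> \<le> \<bar>(f a - u a) \<bullet> F (f c)\<bar> + \<bar>u a \<bullet> F (f c - w c)\<bar>"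
      by simp
    also have "\<dots> \<le> h * ((N + \<bar>\<delta> (b a)\<bar>) * 1) + (1 + h) * ((N + \<bar>\<delta> (b a)\<bar>) * h)"
    proof (rule add_mono)
      have "\<bar>(f a - u a) \<bullet> F (f c)\<bar> \<le> norm (f a - u a) * norm (F (f c))" by (rule Cauchy_Schwarz_ineq2)
      also have "\<dots> \<le> h * ((N + \<bar>\<delta> (b a)\<bar>) * 1)"
        using u(2) FN[of "f c"] nf h(1) by (intro mult_mono) auto
      finally show "\<bar>(f a - u a) \<bullet> F (f c)\<bar> \<le> h * ((N + \<bar>\<delta> (b a)\<bar>) * 1)" .
      have "\<bar>u a \<bullet> F (f c - w c)\<bar> \<le> norm (u a) * norm (F (f c - w c))" by (rule Cauchy_Schwarz_ineq2)
      also have "\<dots> \<le> (1 + h) * ((N + \<bar>\<delta> (b a)\<bar>) * h)"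
        using nu h(1) N0 w(2)[of c]
        by (intro mult_mono order_trans[OF FN] mult_left_mono) auto
      finally show "\<bar>u a \<bullet> F (f c - w c)\<bar> \<le> (1 + h) * ((N + \<bar>\<delta> (b a)\<bar>) * h)" .
    qed
    also have "\<dots> = (2 + h) * (h * (N + \<bar>\<delta> (b a)\<bar>))" by (simp add: algebra_simps)
    also have "\<dots> \<le> 3 * (h * (N + \<bar>\<delta> (b a)\<bar>))"
      using h(1) h1 N0 by (intro mult_right_mono) auto
    finally show ?thesis by simp
  qed
  \<comment> \<open>Summing \<open>est\<close> over the diagonal of a block removes the entries of
    \<open>x\<close> by the trace condition. The part of the bound that contains
    \<open>\<delta>\<close> is absorbed, since \<open>3 * h\<close> is at most one half.\<close>
  have \<delta>: "\<bar>\<delta> (b a)\<bar> \<le> 6 * h * N" for a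
  proof -
    let ?B = "{c. b c = b a}"
    have cp: "0 < card ?B" by (auto simp: card_gt_0_iff)
    have "\<bar>(\<Sum>c\<in>?B. x c c - \<delta> (b a))\<bar> \<le> (\<Sum>c\<in>?B. \<bar>x c c - \<delta> (b a)\<bar>)" by (rule sum_abs)
    also have "\<dots> \<le> (\<Sum>c\<in>?B. 3 * h * (N + \<bar>\<delta> (b a)\<bar>))"
      using est[OF refl] by (intro sum_mono) (metis mem_Collect_eq)
    finally have "real (card ?B) * \<bar>\<delta> (b a)\<bar> \<le> real (card ?B) * (3 * h * (N + \<bar>\<delta> (b a)\<bar>))"
      by (simp add: sum_subtractf xtr abs_mult)
    then have "\<bar>\<delta> (b a)\<bar> \<le> 3 * h * (N + \<bar>\<delta> (b a)\<bar>)" using cp by (simp add: mult_le_cancel_left_pos)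
    moreover have "3 * h * \<bar>\<delta> (b a)\<bar> \<le> 1 / 2 * \<bar>\<delta> (b a)\<bar>" using h1 by (intro mult_right_mono) auto
    ultimately show ?thesis by (simp add: distrib_left)
  qed
  have "\<bar>x a c\<bar> \<le> 12 * h * N" for a c
  proof (cases "b a = b c")
    case True
    have "6 * h * N \<le> 1 * N" using h1 N0 by (intro mult_right_mono) auto
    then have d1: "\<bar>\<delta> (b a)\<bar> \<le> N" using \<delta>[of a] by simp
    then have "3 * h * (N + \<bar>\<delta> (b a)\<bar>) \<le> 3 * h * (2 * N)" using h(1) by (intro mult_left_mono) auto
    then have "\<bar>x a c - (if a = c then \<delta> (b a) else 0)\<bar> \<le> 6 * (h * N)"
      using est[OF True] by linarith
    moreover have "0 \<le> h * N" using h(1) N0 by simp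
    ultimately have "\<bar>x a c\<bar> \<le> 12 * (h * N)"
      using \<delta>[of a] by (cases "a = c") simp_all
    then show ?thesis by simp
  next
    case False
    then show ?thesis using x0 h(1) N0 by simp
  qed
  \<comment> \<open>Summing over all entries multiplies the bound by \<open>CARD('n)^2\<close>; the
    hypothesis on \<open>h\<close> makes the resulting factor at most one half.\<close>
  then have "N \<le> (\<Sum>a\<in>(UNIV::'n set). \<Sum>c\<in>(UNIV::'n set). 12 * h * N)"
    unfolding N_def by (intro sum_mono) (simp add: N_def)
  also have "\<dots> = (24 * (real CARD('n))\<^sup>2 * h) * (N / 2)" by (simp add: power2_eq_square)
  also have "\<dots> \<le> 1 * (N / 2)" using h(2) N0 by (intro mult_right_mono) auto
  finally have "N = 0" using N0 by simp
  then have "E *v v = 0" for v using EN[of v] by simp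
  then have "E = 0" by (metis matrix_eq matrix_vector_mult_0)
  then show ?thesis by (simp add: E_def)
qed


section \<open>Local coordinates with values in the block model\<close>

definition block_chart :: "('n::finite \<Rightarrow> nat) \<Rightarrow> ('n \<Rightarrow> real^'n) \<Rightarrow> real^'n^'n \<Rightarrow> real^'n^'n" where
  "block_chart b f A = (\<chi> a c. if b a < b c then f a \<bullet> (A *v f c)
     else if a = c then \<Sum>e | b e = b a. f e \<bullet> (A *v f e) else 0)"

text \<open>For this purpose the chart repeats the trace of a block on all of its diagonal
  entries.\<close>

lemma block_chart_in_block_model: "block_chart b f A \<in> block_model b"
proof -
  have "\<exists>x. \<forall>a. block_chart b f A $ a $ a = x (b a)"
    by (intro exI[of _ "\<lambda>i. \<Sum>e | b e = i. f e \<bullet> (A *v f e)"]) (simp add: block_chart_def)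
  then show ?thesis by (simp add: block_model_def block_chart_def)
qed

interpretation matrix_vector_mult: bounded_bilinear "(*v) :: real^'m^'n \<Rightarrow> real^'m \<Rightarrow> real^'n"
proof -
  have "bilinear ((*v) :: real^'m^'n \<Rightarrow> real^'m \<Rightarrow> real^'n)"
    unfolding bilinear_def linear_iff
    by (auto simp: vec_eq_iff matrix_vector_mult_def sum_distrib_left sum.distrib algebra_simps)
  then show "bounded_bilinear ((*v) :: real^'m^'n \<Rightarrow> real^'m \<Rightarrow> real^'n)"
    by (simp add: bilinear_conv_bounded_bilinear)
qed

lemma continuous_on_block_chart: "continuous_on U (block_chart b f)"
proof -
  have "linear (block_chart b f)"
    by (auto simp: linear_iff vec_eq_iff block_chart_def matrix_vector_mult.add_left
        matrix_vector_mult.scaleR_left inner_add_right sum.distrib sum_distrib_left)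
  then show ?thesis by (intro linear_continuous_on) (simp add: linear_linear)
qed

lemma finite_inj_gap:
  fixes l :: "'i \<Rightarrow> real"
  assumes "finite S" "inj_on l S"
  obtains \<gamma> where "0 < \<gamma>" "\<And>i j. \<lbrakk>i \<in> S; j \<in> S; i \<noteq> j\<rbrakk> \<Longrightarrow> \<gamma> \<le> \<bar>l i - l j\<bar>"
proof -
  \<comment> \<open>The element 1 keeps the set nonempty when \<open>S\<close> has no two distinct
    elements.\<close>
  let ?G = "insert 1 ((\<lambda>(i, j). \<bar>l i - l j\<bar>) ` {(i, j) \<in> S \<times> S. i \<noteq> j})"
  have fin: "finite ?G"
    using finite_subset[of "{(i, j) \<in> S \<times> S. i \<noteq> j}" "S \<times> S"] assms(1) by auto
  have "x > 0" if x: "x \<in> ?G" for x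
  proof (cases "x = 1")
    case False
    then obtain i j where "x = \<bar>l i - l j\<bar>" "i \<in> S" "j \<in> S" "i \<noteq> j" using x by auto
    then show ?thesis using inj_onD[OF assms(2), of i j] by auto
  qed simp
  then have "0 < Min ?G" using fin by simp
  moreover have "Min ?G \<le> \<bar>l i - l j\<bar>" if "i \<in> S" "j \<in> S" "i \<noteq> j" for i j
    using that fin by (intro Min_le) (auto intro!: image_eqI[of _ _ "(i, j)"])
  ultimately show ?thesis by (rule that)
qed

text \<open>Basis and labelling are those of the centre \<open>A0\<close>. Eigenvectors of any two
  nearby matrices of the set are close to this one basis, so equal chart values force equality by
  \<open>eq_of_perturbed_eigenvectors\<close>.\<close>

lemma block_chart_locally_injective:
  fixes A0 :: "real^'n^'n"
  assumes A0: "A0 \<in> symmetric_matrices_with_multiplicities I k"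
  obtains W b f where "open W" "A0 \<in> W" "range b = {1..I}"
    "\<forall>i\<in>{1..I}. card {a. b a = i} = k i"
    "inj_on (block_chart b f) (symmetric_matrices_with_multiplicities I k \<inter> W)"
proof -
  from A0 obtain l b f where l: "inj_on l {1..I}" and b: "range b = {1..I}"
    and c: "\<forall>i\<in>{1..I}. card {a. b a = i} = k i"
    and f: "orthonormal_family f" and ev: "\<And>a. A0 *v f a = l (b a) *\<^sub>R f a"
    unfolding symmetric_matrices_with_multiplicities_iff by metis
  obtain \<gamma> where \<gamma>: "0 < \<gamma>" "\<And>i j. \<lbrakk>i \<in> {1..I}; j \<in> {1..I}; i \<noteq> j\<rbrakk> \<Longrightarrow> \<gamma> \<le> \<bar>l i - l j\<bar>"
    using finite_inj_gap[OF _ l] by auto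
  obtain C :: real where C: "0 < C" "\<And>(A :: real^'n^'n) v. norm (A *v v) \<le> norm A * norm v * C"
    using matrix_vector_mult.pos_bounded by blast
  define h where "h = 1 / (24 * (real CARD('n))\<^sup>2)"
  have h: "0 < h" "24 * (real CARD('n))\<^sup>2 * h = 1" by (simp_all add: h_def)
  \<comment> \<open>The first bound makes the eigenvector error \<open>2 * e / \<gamma>\<close> at
    most \<open>h\<close>, the second keeps the perturbation below a third of the gap. Dividing by
    \<open>C\<close> below turns the matrix norm into an operator bound.\<close>
  define e where "e = min (\<gamma> * h / 2) (\<gamma> / 3)"
  have e: "0 < e" "3 * e \<le> \<gamma>" "2 * e / \<gamma> \<le> h"
    using \<gamma>(1) h(1) by (auto simp: e_def min_def field_simps)
  have vecs: "\<exists>m u. (\<forall>a. A *v u a = m (b a) *\<^sub>R u a) \<and> (\<forall>a. norm (f a - u a) \<le> h)"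
    if A: "A \<in> symmetric_matrices_with_multiplicities I k \<inter> ball A0 (e / C)" for A
  proof -
    have sym: "transpose A = A" and card: "card (eigenvalues A) = I"
      using A by (auto simp: symmetric_matrices_with_multiplicities_def card_image)
    have "norm (A - A0) * C \<le> e"
      using A C(1) by (simp add: dist_norm norm_minus_commute field_simps)
    then have near: "norm ((A - A0) *v v) \<le> e * norm v" for v
      using C(2)[of "A - A0" v] mult_right_mono[of "norm (A - A0) * C" e "norm v"]
      by (simp add: mult_ac)
    obtain m u where "\<And>a. A *v u a = m (b a) *\<^sub>R u a" "\<And>a. norm (f a - u a) \<le> 2 * e / \<gamma>"
      using perturbed_eigenvectors[OF f ev b \<gamma>(2) e(1,2) near sym card] by metis
    then show ?thesis using e(3) by (meson order_trans)
  qed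
  have "inj_on (block_chart b f) (symmetric_matrices_with_multiplicities I k \<inter> ball A0 (e / C))"
  proof (rule inj_onI)
    fix A A'
    assume A: "A \<in> symmetric_matrices_with_multiplicities I k \<inter> ball A0 (e / C)"
      and A': "A' \<in> symmetric_matrices_with_multiplicities I k \<inter> ball A0 (e / C)"
      and eq: "block_chart b f A = block_chart b f A'"
    have en: "block_chart b f A $ a $ c = block_chart b f A' $ a $ c" for a c
      using eq by simp
    obtain m u where u: "\<forall>a. A *v u a = m (b a) *\<^sub>R u a" "\<forall>a. norm (f a - u a) \<le> h"
      using vecs[OF A] by blast
    obtain m' w where w: "\<forall>a. A' *v w a = m' (b a) *\<^sub>R w a" "\<forall>a. norm (f a - w a) \<le> h"
      using vecs[OF A'] by blast
    show "A = A'"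
    proof (rule eq_of_perturbed_eigenvectors[OF f])
      show "transpose A = A" "transpose A' = A'"
        using A A' by (auto simp: symmetric_matrices_with_multiplicities_def)
      show "f a \<bullet> (A *v f c) = f a \<bullet> (A' *v f c)" if "b a < b c" for a c
        using en[of a c] that by (simp add: block_chart_def)
      show "(\<Sum>a | b a = i. f a \<bullet> (A *v f a)) = (\<Sum>a | b a = i. f a \<bullet> (A' *v f a))" for i
      proof (cases "i \<in> range b")
        case True
        then obtain a where "i = b a" by blast
        then show ?thesis using en[of a a] by (simp add: block_chart_def)
      next
        case False
        then have "{a. b a = i} = {}" by blast
        then show ?thesis by simp
      qed
    qed (use u w h in auto)
  qed
  moreover have "A0 \<in> ball A0 (e / C)" using e C by simp
  ultimately show ?thesis using b c by (intro that[of "ball A0 (e / C)" b f]) auto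
qed

text \<open>Composing the inverse chart \<open>G\<close> with \<open>\<phi>\<close> gives a
  continuous injection of a nonempty relatively open subset of \<open>T\<close> into
  \<open>N\<close>, so invariance of domain applies.\<close>

lemma C1_submanifold_dim_le_of_local_injection:
  fixes M :: "'a::euclidean_space set" and \<phi> :: "'a \<Rightarrow> 'b::euclidean_space"
  assumes M: "C1_submanifold d M" "p \<in> M" and W: "open W" "p \<in> W"
    and \<phi>: "continuous_on (M \<inter> W) \<phi>" "inj_on \<phi> (M \<inter> W)" "\<phi> ` (M \<inter> W) \<subseteq> N" and N: "subspace N"
  shows "d \<le> dim N"
proof -
  obtain U V F G T where p: "p \<in> U" and diff: "C1_diffeomorphism U V F G"
    and T: "subspace T" "dim T = d" and im: "F ` (M \<inter> U) = T \<inter> V"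
    using M unfolding C1_submanifold_def by blast
  have V: "open V" and hom: "homeomorphism U V F G"
    using diff by (auto simp: C1_diffeomorphism_def)
  define S where "S = T \<inter> (V \<inter> G -` W)"
  have GF: "G (F x) = x" if "x \<in> U" for x using hom that by (auto simp: homeomorphism_def)
  have FG: "F (G y) = y" if "y \<in> V" for y using hom that by (auto simp: homeomorphism_def)
  have cG: "continuous_on V G" using hom by (simp add: homeomorphism_def)
  have "open (V \<inter> G -` W)" using cG V W(1) by (rule continuous_open_preimage)
  then have op: "openin (top_of_set T) S" unfolding S_def by (rule openin_open_Int)
  \<comment> \<open>A point of \<open>T \<inter> V\<close> is the chart image of a point of
    \<open>M\<close>, so \<open>G\<close> brings it back to \<open>M\<close>; the preimage in
    \<open>S\<close> takes care of \<open>W\<close>.\<close>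
  have GS: "G y \<in> M \<inter> W" if y: "y \<in> S" for y
  proof -
    have "y \<in> F ` (M \<inter> U)" using y im by (auto simp: S_def)
    then obtain x where "x \<in> M" "x \<in> U" "y = F x" by blast
    then show ?thesis using y GF by (auto simp: S_def)
  qed
  have "continuous_on S (\<phi> \<circ> G)"
    using GS by (intro continuous_on_compose continuous_on_subset[OF cG] continuous_on_subset[OF \<phi>(1)])
      (auto simp: S_def)
  moreover have "inj_on (\<phi> \<circ> G) S"
  proof (rule inj_onI)
    fix x y assume xy: "x \<in> S" "y \<in> S" "(\<phi> \<circ> G) x = (\<phi> \<circ> G) y"
    then have "G x = G y" using inj_onD[OF \<phi>(2)] GS by auto
    then show "x = y" using FG xy(1,2) unfolding S_def by (metis IntD1 IntD2)
  qed
  moreover have "\<phi> \<circ> G \<in> S \<rightarrow> N" using \<phi>(3) GS by auto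
  moreover have "F p \<in> S"
  proof -
    have "F p \<in> T \<inter> V" using im M(2) p by blast
    then show ?thesis using GF[OF p] W(2) by (simp add: S_def)
  qed
  ultimately show ?thesis
    using invariance_of_dimension_subspaces[OF op T(1) N] T(2) by blast
qed

theorem corollary5p1:
  fixes I :: nat and k :: "nat \<Rightarrow> nat"
  assumes "\<And>i. i \<in> {1..I} \<Longrightarrow> k i > 0"
    and "(\<Sum>i=1..I. k i) = CARD('n::finite)"
  shows "real (real_dim (symmetric_matrices_with_multiplicities I k :: (real^'n^'n) set)) =
    real CARD('n) * (real CARD('n) - 1) / 2 + real I
      - (\<Sum>i=1..I. real (k i) * (real (k i) - 1) / 2)"
proof -
  let ?S = "symmetric_matrices_with_multiplicities I k :: (real^'n^'n) set"
  obtain b :: "'n \<Rightarrow> nat" where b: "range b = {1..I}" and "\<forall>i\<in>{1..I}. card {a. b a = i} = k i"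
    using ex_block_function[OF assms] by blast
  then have fibers: "\<And>i. i \<in> {1..I} \<Longrightarrow> card {a. b a = i} = k i" by blast
  \<comment> \<open>The supremum is attained: the Cayley submanifold supplies the value, and block
    charts bound every competitor.\<close>
  have "real_dim ?S = dim (block_model b)"
    unfolding real_dim_def
  proof (rule cSup_eq_maximum)
    show "dim (block_model b) \<in> {d. \<exists>M. M \<noteq> {} \<and> M \<subseteq> ?S \<and> C1_submanifold d M}"
    proof -
      obtain M :: "(real^'n^'n) set" where "M \<noteq> {}" "M \<subseteq> ?S" "C1_submanifold (dim (block_model b)) M"
        by (rule ex_submanifold[OF b fibers])
      then show ?thesis by blast
    qed
    fix d assume "d \<in> {d. \<exists>M. M \<noteq> {} \<and> M \<subseteq> ?S \<and> C1_submanifold d M}"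
    then obtain M p where M: "p \<in> M" "M \<subseteq> ?S" "C1_submanifold d M" by blast
    have "p \<in> ?S" using M by blast
    then obtain W b' f where W: "open W" "p \<in> W" and b': "range b' = {1..I}"
      and "\<forall>i\<in>{1..I}. card {a. b' a = i} = k i" and inj: "inj_on (block_chart b' f) (?S \<inter> W)"
      by (rule block_chart_locally_injective)
    then have fibers': "\<And>i. i \<in> {1..I} \<Longrightarrow> card {a. b' a = i} = k i" by blast
    have "d \<le> dim (block_model b')"
    proof (rule C1_submanifold_dim_le_of_local_injection[OF M(3,1) W continuous_on_block_chart])
      show "inj_on (block_chart b' f) (M \<inter> W)" using M(2) by (intro inj_on_subset[OF inj]) blast
      show "block_chart b' f ` (M \<inter> W) \<subseteq> block_model b'" using block_chart_in_block_model by blast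
    qed (rule subspace_block_model)
    \<comment> \<open>The labelling \<open>b'\<close> comes from the point \<open>p\<close> and may
      differ from \<open>b\<close>, but both have the fibre sizes \<open>k\<close>.\<close>
    also have "dim (block_model b') = dim (block_model b)"
      using real_dim_block_model[OF b fibers assms(2)] real_dim_block_model[OF b' fibers' assms(2)]
      by linarith
    finally show "d \<le> dim (block_model b)" .
  qed
  then show ?thesis using real_dim_block_model[OF b fibers assms(2)] by simp
qed

end
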